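(* Let $k\ge 1$ and $m\ge 2$ be integers. There is a constant $c'>0$, depending only on $k$ and $m$, such that the following holds. Suppose $R$ is a ring and $S\subseteq R$ is a nonempty finite subset satisfying $$\mathrm{E}(S) > c'\,|S|^{3-\frac{1}{5(2^{k+1}-1)}}.$$ Then: (1) There exist distinct subsets $A_1,A_2,\ldots,A_m\subseteq S$ with $|A_i|=\lceil \log_2 m\rceil 2^k$ for every $i$, such that $$\sum_{a\in A_i}a^j=\sum_{b\in A_1}b^j\qquad\text{for } j=1,\ldots,k \text{ and } i=1,\ldots,m.$$ (2) Assume additionally that $R$ is an integral domain with characteristic $\mathrm{char}(R)=0$ or $\mathrm{char}(R)>k+1$. Then there exist $A_1,A_2,\ldots,A_m\subseteq S$ with $|A_i|=\lceil\log_2 m\rceil 2^k$ for every $i$, such that $$\sum_{a\in A_i}a^j=\sum_{b\in A_1}b^j\qquad\text{for } j=1,\ldots,k \text{ and } i=1,\ldots,m,$$ while for all $h,t\in\{1,2,\ldots,m\}$ with $h\ne t$, $$\sum_{a\in A_h}a^{k+1}\ne\sum_{b\in A_t}b^{k+1}.$$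
   Context: Rings are not necessarily commutative. An integral domain is a nonzero commutative ring with a multiplicative identity and no zero divisors. The additive energy of a finite subset $S$ of a ring is $\mathrm{E}(S)=\#\{(a_1,a_2,b_1,b_2)\in S^4: a_1+a_2=b_1+b_2\}$. *)

theory Defs
  imports Complex_Main "HOL-Algebra.Ring"
begin

text \<open>
  The rings of the corollary are associative, but they need neither be commutative nor have a
  multiplicative identity (only integral domains are required to have one). The locale
  \<open>ring\<close> of HOL-Algebra asks for an identity, so the following one does not mention the
  field \<open>one\<close> of the record, whose value is irrelevant.
\<close>

locale nonunital_ring = abelian_group R for R (structure) +
  assumes m_closed: "\<lbrakk>x \<in> carrier R; y \<in> carrier R\<rbrakk> \<Longrightarrow> x \<otimes> y \<in> carrier R"
    and m_assoc: "\<lbrakk>x \<in> carrier R; y \<in> carrier R; z \<in> carrier R\<rbrakk>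
      \<Longrightarrow> (x \<otimes> y) \<otimes> z = x \<otimes> (y \<otimes> z)"
    and l_distr: "\<lbrakk>x \<in> carrier R; y \<in> carrier R; z \<in> carrier R\<rbrakk>
      \<Longrightarrow> (x \<oplus> y) \<otimes> z = x \<otimes> z \<oplus> y \<otimes> z"
    and r_distr: "\<lbrakk>x \<in> carrier R; y \<in> carrier R; z \<in> carrier R\<rbrakk>
      \<Longrightarrow> z \<otimes> (x \<oplus> y) = z \<otimes> x \<oplus> z \<otimes> y"

lemma (in ring) is_nonunital_ring: "nonunital_ring R"
  by (intro nonunital_ring.intro nonunital_ring_axioms.intro abelian_group_axioms)
     (auto simp: m_assoc l_distr r_distr)

text \<open>
  The power \<open>a\<^sup>j\<close> for \<open>j \<ge> 1\<close>, without reference to an identity; the value at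
  \<open>j = 0\<close> is junk and is never used.
\<close>

definition pos_pow :: "('a, 'b) ring_scheme \<Rightarrow> 'a \<Rightarrow> nat \<Rightarrow> 'a" where
  "pos_pow R a j = ((\<lambda>x. x \<otimes>\<^bsub>R\<^esub> a) ^^ (j - 1)) a"

lemma pos_pow_1: "pos_pow R a 1 = a"
  by (simp add: pos_pow_def)

lemma pos_pow_Suc: "j \<ge> 1 \<Longrightarrow> pos_pow R a (Suc j) = pos_pow R a j \<otimes>\<^bsub>R\<^esub> a"
  by (cases j) (simp_all add: pos_pow_def)

lemma (in ring) pos_pow_eq_pow:
  assumes "a \<in> carrier R" "j \<ge> 1"
  shows "pos_pow R a j = a [^] j"
  using assms(2)
proof (induction j rule: dec_induct)
  case base
  show ?case using assms(1) by (simp add: pos_pow_def)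
next
  case (step n)
  then show ?case by (simp add: pos_pow_Suc)
qed

definition power_sum :: "('a, 'b) ring_scheme \<Rightarrow> nat \<Rightarrow> 'a set \<Rightarrow> 'a" where
  "power_sum R j A = (\<Oplus>\<^bsub>R\<^esub>a\<in>A. pos_pow R a j)"

definition additive_energy :: "('a, 'b) ring_scheme \<Rightarrow> 'a set \<Rightarrow> nat" where
  "additive_energy R S =
     card {(a1, a2, b1, b2). a1 \<in> S \<and> a2 \<in> S \<and> b1 \<in> S \<and> b2 \<in> S \<and> a1 \<oplus>\<^bsub>R\<^esub> a2 = b1 \<oplus>\<^bsub>R\<^esub> b2}"

definition ring_characteristic :: "('a, 'b) ring_scheme \<Rightarrow> nat" where
  "ring_characteristic R =
     (if \<exists>n::nat. n > 0 \<and> [n] \<cdot>\<^bsub>R\<^esub> \<one>\<^bsub>R\<^esub> = \<zero>\<^bsub>R\<^esub>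
      then LEAST n::nat. n > 0 \<and> [n] \<cdot>\<^bsub>R\<^esub> \<one>\<^bsub>R\<^esub> = \<zero>\<^bsub>R\<^esub>
      else 0)"

text \<open>
  \<open>A\<close> is a family \<open>A 1, \<dots>, A m\<close> of subsets of \<open>S\<close> of the prescribed size whose
  power sums of degrees \<open>1, \<dots>, k\<close> agree.
\<close>

definition equal_power_sums ::
    "('a, 'b) ring_scheme \<Rightarrow> 'a set \<Rightarrow> nat \<Rightarrow> nat \<Rightarrow> (nat \<Rightarrow> 'a set) \<Rightarrow> bool" where
  "equal_power_sums R S k m A \<longleftrightarrow>
     (\<forall>i\<in>{1..m}. A i \<subseteq> S \<and> card (A i) = nat \<lceil>log 2 (real m)\<rceil> * 2 ^ k) \<and>
     (\<forall>j\<in>{1..k}. \<forall>i\<in>{1..m}. power_sum R j (A i) = power_sum R j (A 1))"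

text \<open>
  \<open>energy_constant TYPE('a) k m c\<close>: the constant \<open>c\<close> has the asserted property for all
  rings whose elements have type \<open>'a\<close> (the carrier may be any set of elements).
\<close>

definition energy_constant :: "'a itself \<Rightarrow> nat \<Rightarrow> nat \<Rightarrow> real \<Rightarrow> bool" where
  "energy_constant (_ :: 'a itself) k m c \<longleftrightarrow>
     (\<forall>(R :: 'a ring) S.
        nonunital_ring R \<longrightarrow> S \<subseteq> carrier R \<longrightarrow> finite S \<longrightarrow> S \<noteq> {} \<longrightarrow>
        real (additive_energy R S)
          > c * real (card S) powr (3 - 1 / (5 * (2 ^ (k + 1) - 1))) \<longrightarrow>
        (\<exists>A. inj_on A {1..m} \<and> equal_power_sums R S k m A) \<and>
        (domain R \<and> (ring_characteristic R = 0 \<or> ring_characteristic R > k + 1) \<longrightarrow>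
          (\<exists>A. equal_power_sums R S k m A \<and>
               (\<forall>h\<in>{1..m}. \<forall>t\<in>{1..m}. h \<noteq> t \<longrightarrow>
                  power_sum R (k + 1) (A h) \<noteq> power_sum R (k + 1) (A t)))))"

text \<open>
  The constant has to depend on \<open>k\<close> and \<open>m\<close> only, and so must serve the rings over every
  type, but an existential quantifier in a polymorphic statement may pick a different witness at
  each type instance. Existence is therefore stated at the single type \<open>nat\<close>, together with:
  any constant that is good at \<open>nat\<close> is good at an arbitrary type \<open>'a\<close>. Hence one
  choice of \<open>c\<close>, made before \<open>'a\<close>, works for all rings. (The second part loses nothing:
  a finite set generates a countable subring, which is isomorphic to a ring with carrier in
  \<open>nat\<close>.)
\<close>

end

theory Submission
  imports Defs "HOL-Analysis.Convex" "HOL-Library.Countable_Set"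
begin

text \<open>
  Put \<open>d = k + 1\<close>, \<open>n = |S|\<close> and \<open>E(S) = \<kappa> n\<^sup>3\<close>. By the Balog--Szemeredi--Gowers theorem some
  \<open>A \<subseteq> S\<close> has \<open>|A| \<ge> \<kappa> n / 8\<close> and \<open>|A - A| \<le> 2048 \<kappa>\<^sup>-\<^sup>3 n\<close>; iterating Cauchy--Schwarz over the differences,
  \<open>A\<close> contains a constant times \<open>\<kappa>\<^sup>p n\<^sup>d\<^sup>+\<^sup>1\<close> cubes of dimension \<open>d\<close>, with
  \<open>p = 4 \<sqdot> 2\<^sup>d - 3 d - 3 \<le> 5 (2\<^sup>d - 1)\<close>. Only \<open>O(n\<^sup>d)\<close> cubes are degenerate, meet a given
  bounded set, or have their product of edges times \<open>d!\<close> in a given bounded set (in a domain with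
  \<open>d! \<noteq> 0\<close>), because each of these conditions leaves boundedly many choices for one edge once
  the rest of the cube is fixed. The vertices of a proper cube split by parity into two halves of size
  \<open>2\<^sup>k\<close>; the difference of their \<open>j\<close>-th power sums is a \<open>d\<close>-fold iterated difference of \<open>x\<^sup>j\<close>,
  so it vanishes for \<open>j \<le> k\<close> and is \<open>d!\<close> times the product of the edges for \<open>j = d\<close>. Choosing one
  half of each of \<open>\<lceil>log\<^sub>2 m\<rceil>\<close> disjoint cubes gives at least \<open>m\<close> sets. The cubes are chosen one after the
  other, such that the new difference of \<open>d\<close>-th power sums is none of those between the
  sets built so far.

  That a constant which is good for carriers in \<open>nat\<close> is good in general follows by copying the
  subring generated by \<open>S\<close>, and by the identity if there is one, to \<open>nat\<close>.
\<close>

section \<open>Additive energy and small difference sets\<close>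

context abelian_group
begin

lemma a_left_cancelD: "\<lbrakk>x \<oplus> y = x \<oplus> z; x \<in> carrier G; y \<in> carrier G; z \<in> carrier G\<rbrakk> \<Longrightarrow> y = z"
  by (metis r_neg1)

lemma a_right_cancelD: "\<lbrakk>y \<oplus> x = z \<oplus> x; x \<in> carrier G; y \<in> carrier G; z \<in> carrier G\<rbrakk> \<Longrightarrow> y = z"
  by (metis a_comm a_left_cancelD)

lemma a_minus_eq_iff:
  "\<lbrakk>x \<in> carrier G; y \<in> carrier G; z \<in> carrier G\<rbrakk> \<Longrightarrow> x \<ominus> y = z \<longleftrightarrow> x = z \<oplus> y"
  by (auto simp: minus_eq a_assoc l_neg r_neg)

lemma a_add_diff_cancel [simp]:
  "\<lbrakk>x \<in> carrier G; y \<in> carrier G\<rbrakk> \<Longrightarrow> y \<oplus> (x \<ominus> y) = x"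
  by (metis a_minus_eq_iff minus_closed a_comm)

lemma a_minus_self [simp]: "x \<in> carrier G \<Longrightarrow> x \<ominus> x = \<zero>"
  by (simp add: minus_eq r_neg)

lemma inj_on_translate: "h \<in> carrier G \<Longrightarrow> A \<subseteq> carrier G \<Longrightarrow> inj_on (\<lambda>v. v \<oplus> h) A"
  by (rule inj_onI) (meson a_right_cancelD subsetD)

definition diff_set :: "'a set \<Rightarrow> 'a set" where
  "diff_set A = (\<lambda>(x, y). x \<ominus> y) ` (A \<times> A)"

text \<open>The set \<open>A\<close> intersected with its translate by \<open>-h\<close>; its size
  is the number of representations of \<open>h\<close> as a difference of two elements of
  \<open>A\<close>.\<close>

definition shift_inter :: "'a set \<Rightarrow> 'a \<Rightarrow> 'a set" where
  "shift_inter A h = {y \<in> A. y \<oplus> h \<in> A}"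

lemma finite_diff_set: "finite A \<Longrightarrow> finite (diff_set A)"
  by (simp add: diff_set_def)

lemma diff_set_carrier: "A \<subseteq> carrier G \<Longrightarrow> diff_set A \<subseteq> carrier G"
  by (auto simp: diff_set_def)

lemma diff_set_memI: "x \<in> A \<Longrightarrow> y \<in> A \<Longrightarrow> x \<ominus> y \<in> diff_set A"
  by (auto simp: diff_set_def)

lemma diff_set_mono: "A \<subseteq> B \<Longrightarrow> diff_set A \<subseteq> diff_set B"
  by (auto simp: diff_set_def)

lemma card_diff_set_le: "finite A \<Longrightarrow> card (diff_set A) \<le> card A * card A"
  unfolding diff_set_def by (metis card_cartesian_product card_image_le finite_SigmaI)

lemma shift_inter_subset: "shift_inter A h \<subseteq> A"
  by (auto simp: shift_inter_def)

text \<open>A pair \<open>(h, y)\<close> with \<open>y \<in> shift_inter A h\<close> amounts to the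
  pair \<open>(y, y \<oplus> h)\<close> in \<open>A \<times> A\<close>.\<close>

lemma sum_card_shift_inter:
  assumes "finite A" "A \<subseteq> carrier G"
  shows "(\<Sum>h\<in>diff_set A. card (shift_inter A h)) = card A * card A"
proof -
  have "(\<Sum>h\<in>diff_set A. card (shift_inter A h)) = card (Sigma (diff_set A) (shift_inter A))"
    using assms by (subst card_SigmaI) (auto simp: finite_diff_set shift_inter_def)
  also have "\<dots> = card (A \<times> A)"
  proof (rule bij_betw_same_card[of "\<lambda>(h, y). (y, y \<oplus> h)"], rule bij_betwI')
    fix p q assume p: "p \<in> Sigma (diff_set A) (shift_inter A)" and q: "q \<in> Sigma (diff_set A) (shift_inter A)"
    then obtain h y h' y' where hy: "p = (h, y)" "q = (h', y')" by force
    have "h \<in> carrier G" "h' \<in> carrier G" "y \<in> carrier G"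
      using p q hy diff_set_carrier[OF assms(2)] assms(2) by (auto simp: shift_inter_def)
    then show "((case p of (h, y) \<Rightarrow> (y, y \<oplus> h)) = (case q of (h, y) \<Rightarrow> (y, y \<oplus> h))) = (p = q)"
      using hy by (auto dest: a_left_cancelD)
  next
    fix p assume "p \<in> Sigma (diff_set A) (shift_inter A)"
    then show "(case p of (h, y) \<Rightarrow> (y, y \<oplus> h)) \<in> A \<times> A"
      by (auto simp: shift_inter_def)
  next
    fix q assume "q \<in> A \<times> A"
    then obtain y z where q: "q = (y, z)" "y \<in> A" "z \<in> A" by auto
    then have "y \<oplus> (z \<ominus> y) = z" using assms(2) by (simp add: subset_iff)
    with q show "\<exists>p\<in>Sigma (diff_set A) (shift_inter A). q = (case p of (h, y) \<Rightarrow> (y, y \<oplus> h))"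
      by (intro bexI[of _ "(z \<ominus> y, y)"]) (auto simp: shift_inter_def diff_set_memI)
  qed
  finally show ?thesis by (simp add: card_cartesian_product)
qed

text \<open>In \<open>a1 \<oplus> a2 = b1 \<oplus> b2\<close> the differences
  \<open>a1 \<ominus> b1\<close> and \<open>b2 \<ominus> a2\<close> are the same \<open>h\<close>,
  so the quadruple is recovered from \<open>h\<close>, \<open>b1\<close> and
  \<open>a2\<close>.\<close>

lemma additive_energy_le:
  assumes "finite S" "S \<subseteq> carrier G"
  shows "additive_energy G S \<le> (\<Sum>h\<in>diff_set S. (card (shift_inter S h))\<^sup>2)"
proof -
  let ?Q = "{(a1, a2, b1, b2). a1 \<in> S \<and> a2 \<in> S \<and> b1 \<in> S \<and> b2 \<in> S \<and> a1 \<oplus> a2 = b1 \<oplus> b2}"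
  let ?P = "Sigma (diff_set S) (\<lambda>h. shift_inter S h \<times> shift_inter S h)"
  have fin: "finite ?P"
    using assms by (auto simp: finite_diff_set shift_inter_def)
  have "?Q \<subseteq> (\<lambda>(h, y, z). (y \<oplus> h, z, y, z \<oplus> h)) ` ?P"
  proof clarify
    fix a1 a2 b1 b2
    assume m: "a1 \<in> S" "a2 \<in> S" "b1 \<in> S" "b2 \<in> S" and eq: "a1 \<oplus> a2 = b1 \<oplus> b2"
    then have c: "a1 \<in> carrier G" "a2 \<in> carrier G" "b1 \<in> carrier G" "b2 \<in> carrier G"
      using assms(2) by auto
    have "b1 \<oplus> (a2 \<oplus> (a1 \<ominus> b1)) = a2 \<oplus> (b1 \<oplus> (a1 \<ominus> b1))"
      using c by (simp add: a_lcomm del: a_add_diff_cancel)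
    also have "\<dots> = b1 \<oplus> b2" using c eq by (simp add: a_comm)
    finally have "a2 \<oplus> (a1 \<ominus> b1) = b2" using c by (auto dest: a_left_cancelD)
    moreover have "b1 \<oplus> (a1 \<ominus> b1) = a1" using c by simp
    ultimately show "(a1, a2, b1, b2) \<in> (\<lambda>(h, y, z). (y \<oplus> h, z, y, z \<oplus> h)) ` ?P"
      using m by (intro image_eqI[of _ _ "(a1 \<ominus> b1, b1, a2)"]) (auto simp: shift_inter_def diff_set_memI)
  qed
  then have "additive_energy G S \<le> card ?P"
    unfolding additive_energy_def using fin surj_card_le by blast
  also have "\<dots> = (\<Sum>h\<in>diff_set S. (card (shift_inter S h))\<^sup>2)"
    using assms by (subst card_SigmaI)
      (auto simp: finite_diff_set shift_inter_def card_cartesian_product power2_eq_square)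
  finally show ?thesis .
qed

text \<open>One factor of each square is at most \<open>card S\<close>, and the other factors add up
  to \<open>card S ^ 2\<close>. This later yields \<open>\<kappa> \<le> 1\<close>.\<close>

lemma additive_energy_le_cube:
  assumes "finite S" "S \<subseteq> carrier G"
  shows "additive_energy G S \<le> card S ^ 3"
proof -
  have "additive_energy G S \<le> (\<Sum>h\<in>diff_set S. card (shift_inter S h) * card S)"
    using additive_energy_le[OF assms]
    by (rule order_trans)
       (auto intro!: sum_mono mult_left_mono card_mono simp: assms power2_eq_square shift_inter_def)
  also have "\<dots> = card S ^ 3"
    unfolding sum_distrib_right[symmetric] sum_card_shift_inter[OF assms]
    by (simp add: power3_eq_cube)
  finally show ?thesis .
qed

text \<open>
  Choosing the set \<open>S \<inter> (S - h)\<close> with a suitable \<open>h\<close> instead of a neighbourhood in the graph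
  of popular differences improves the popularity threshold from \<open>\<kappa>\<^sup>2 |S|\<close> to \<open>\<kappa> |S|\<close>; this
  is the source of the exponent \<open>-3\<close> below.
\<close>

lemma popular_shift:
  fixes \<kappa> :: real
  assumes "finite S" "S \<subseteq> carrier G"
    and \<kappa>: "\<kappa> > 0" "S \<noteq> {}" "real (additive_energy G S) = \<kappa> * real (card S) ^ 3"
  defines "t \<equiv> \<kappa> * real (card S) / 16"
  defines "bad \<equiv> \<lambda>x y. real (card (shift_inter S (x \<ominus> y))) < t"
  obtains h where "h \<in> diff_set S"
    "real (card (shift_inter S h)) > \<kappa> * real (card S) / 4"
    "8 * real (card {(x, y). x \<in> shift_inter S h \<and> y \<in> shift_inter S h \<and> bad x y})
       < real (card (shift_inter S h)) ^ 2"
proof -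
  let ?n = "real (card S)"
  let ?r = "\<lambda>h. real (card (shift_inter S h))"
  let ?bad = "\<lambda>h. {(x, y). x \<in> shift_inter S h \<and> y \<in> shift_inter S h \<and> bad x y}"
  have n0: "?n > 0" using assms by (simp add: card_gt_0_iff)
  have t0: "t > 0" using n0 \<kappa> by (simp add: t_def)
  have finD: "finite (diff_set S)" using assms finite_diff_set by blast
  have finb: "finite (?bad h)" for h
    by (rule finite_subset[of _ "S \<times> S"]) (use assms in \<open>auto simp: shift_inter_def\<close>)
  \<comment> \<open>Double counting: the triples \<open>(h, x, y)\<close> are regrouped by the bad
    pair \<open>(x, y)\<close>.\<close>
  have "(\<Sum>h\<in>diff_set S. card (?bad h)) = card (Sigma (diff_set S) ?bad)"
    using finD finb by (subst card_SigmaI) auto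
  also have "Sigma (diff_set S) ?bad
      = (\<lambda>((x, y), h). (h, x, y)) ` (SIGMA p:{(x, y). x \<in> S \<and> y \<in> S \<and> bad x y}.
           {h \<in> diff_set S. fst p \<oplus> h \<in> S \<and> snd p \<oplus> h \<in> S})"
    by (auto simp: shift_inter_def image_iff)
  also have "card \<dots> = card (SIGMA p:{(x, y). x \<in> S \<and> y \<in> S \<and> bad x y}.
           {h \<in> diff_set S. fst p \<oplus> h \<in> S \<and> snd p \<oplus> h \<in> S})"
    by (rule card_image) (auto simp: inj_on_def)
  also have "\<dots> = (\<Sum>p\<in>{(x, y). x \<in> S \<and> y \<in> S \<and> bad x y}.
           card {h \<in> diff_set S. fst p \<oplus> h \<in> S \<and> snd p \<oplus> h \<in> S})"
    using finD assms(1)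
    by (intro card_SigmaI) (auto intro: finite_subset[of _ "S \<times> S"])
  finally have "real (\<Sum>h\<in>diff_set S. card (?bad h)) = (\<Sum>p\<in>{(x, y). x \<in> S \<and> y \<in> S \<and> bad x y}.
           real (card {h \<in> diff_set S. fst p \<oplus> h \<in> S \<and> snd p \<oplus> h \<in> S}))"
    by simp
  also have "\<dots> \<le> (\<Sum>p\<in>{(x, y). x \<in> S \<and> y \<in> S \<and> bad x y}. t)"
  proof (rule sum_mono, clarify)
    fix x y assume xy: "x \<in> S" "y \<in> S" "bad x y"
    then have c: "x \<in> carrier G" "y \<in> carrier G" using assms by auto
    \<comment> \<open>If \<open>h\<close> moves both \<open>x\<close> and \<open>y\<close> into
      \<open>S\<close>, then \<open>y \<oplus> h\<close> is a point of \<open>S\<close> whose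
      translate by \<open>x \<ominus> y\<close> is \<open>x \<oplus> h\<close>. Hence a bad pair is
      counted fewer than \<open>t\<close> times.\<close>
    have "card {h \<in> diff_set S. x \<oplus> h \<in> S \<and> y \<oplus> h \<in> S} \<le> card (shift_inter S (x \<ominus> y))"
    proof (rule card_inj_on_le)
      show "inj_on (\<lambda>h. y \<oplus> h) {h \<in> diff_set S. x \<oplus> h \<in> S \<and> y \<oplus> h \<in> S}"
        by (rule inj_onI) (use diff_set_carrier[OF assms(2)] c in \<open>auto dest: a_left_cancelD\<close>)
      show "finite (shift_inter S (x \<ominus> y))" using assms by (simp add: shift_inter_def)
      show "(\<lambda>h. y \<oplus> h) ` {h \<in> diff_set S. x \<oplus> h \<in> S \<and> y \<oplus> h \<in> S} \<subseteq> shift_inter S (x \<ominus> y)"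
      proof clarify
        fix h assume h: "h \<in> diff_set S" "x \<oplus> h \<in> S" "y \<oplus> h \<in> S"
        have hc: "h \<in> carrier G" using h diff_set_carrier[OF assms(2)] by auto
        have "y \<oplus> h \<oplus> (x \<ominus> y) = (y \<oplus> (x \<ominus> y)) \<oplus> h"
          using c hc by (simp add: a_ac del: a_add_diff_cancel)
        also have "\<dots> = x \<oplus> h" using c by simp
        finally show "y \<oplus> h \<in> shift_inter S (x \<ominus> y)" using h by (simp add: shift_inter_def)
      qed
    qed
    then show "real (card {h \<in> diff_set S. fst (x, y) \<oplus> h \<in> S \<and> snd (x, y) \<oplus> h \<in> S}) \<le> t"
      using xy(3) by (simp add: bad_def)
  qed
  also have "\<dots> = real (card {(x, y). x \<in> S \<and> y \<in> S \<and> bad x y}) * t" by simp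
  also have "\<dots> \<le> real (card (S \<times> S)) * t"
    using t0 assms(1) by (intro mult_right_mono of_nat_mono card_mono) auto
  also have "\<dots> = \<kappa> * ?n ^ 3 / 16"
    by (simp add: t_def card_cartesian_product power3_eq_cube)
  finally have 1: "(\<Sum>h\<in>diff_set S. real (card (?bad h))) \<le> \<kappa> * ?n ^ 3 / 16" by simp
  have 2: "(\<Sum>h\<in>diff_set S. ?r h) = ?n\<^sup>2"
    using sum_card_shift_inter[OF assms(1,2)]
    by (metis of_nat_mult of_nat_sum power2_eq_square)
  have "real (additive_energy G S) \<le> real (\<Sum>h\<in>diff_set S. (card (shift_inter S h))\<^sup>2)"
    using additive_energy_le[OF assms(1,2)] by (rule of_nat_mono)
  then have 3: "(\<Sum>h\<in>diff_set S. (?r h)\<^sup>2) \<ge> \<kappa> * ?n ^ 3" using \<kappa> by simp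
  \<comment> \<open>The weights satisfy \<open>8 / 16 + 1 / 4 = 3 / 4 < 1\<close>. An
    \<open>h\<close> for which the square exceeds the sum of the two terms exceeds each of them,
    which gives both conclusions at once.\<close>
  have "(\<Sum>h\<in>diff_set S. 8 * real (card (?bad h)) + \<kappa> * ?n / 4 * ?r h)
      = 8 * (\<Sum>h\<in>diff_set S. real (card (?bad h))) + \<kappa> * ?n / 4 * (\<Sum>h\<in>diff_set S. ?r h)"
    by (simp only: sum.distrib sum_distrib_left)
  also have "\<dots> \<le> 8 * (\<kappa> * ?n ^ 3 / 16) + \<kappa> * ?n / 4 * ?n\<^sup>2"
    by (subst 2) (use 1 in linarith)
  also have "\<dots> = 3 / 4 * (\<kappa> * ?n ^ 3)" by (simp add: power2_eq_square power3_eq_cube)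
  also have "\<dots> < \<kappa> * ?n ^ 3" using \<kappa>(1) n0 by simp
  also note 3
  finally obtain h where h: "h \<in> diff_set S"
    "8 * real (card (?bad h)) + \<kappa> * ?n / 4 * ?r h < (?r h)\<^sup>2"
    by (meson not_less sum_mono)
  have "\<kappa> * ?n / 4 * ?r h \<ge> 0" using \<kappa> by simp
  then have a: "8 * real (card (?bad h)) < (?r h)\<^sup>2" using h(2) by linarith
  have "\<kappa> * ?n / 4 * ?r h < ?r h * ?r h" using h(2) unfolding power2_eq_square by linarith
  then have "\<kappa> * ?n / 4 < ?r h"
    by (rule mult_right_less_imp_less) simp
  with h(1) a show thesis using that by blast
qed

text \<open>In \<open>B = shift_inter S h\<close> most pairs have a popular difference, and
  \<open>A\<close> collects the elements with few bad partners. Any \<open>x\<close> and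
  \<open>x'\<close> in \<open>A\<close> share at least half of \<open>B\<close> as good partners
  \<open>y\<close>. Writing \<open>x \<ominus> x'\<close> as
  \<open>(x \<ominus> y) \<ominus> (x' \<ominus> y)\<close> gives many representations by quadruples
  from \<open>S\<close>, of which there are only \<open>card S ^ 4\<close>.\<close>

theorem balog_szemeredi_gowers:
  fixes \<kappa> :: real
  assumes "finite S" "S \<subseteq> carrier G"
    and \<kappa>: "\<kappa> > 0" "S \<noteq> {}" "real (additive_energy G S) = \<kappa> * real (card S) ^ 3"
  obtains A where "A \<subseteq> S" "real (card A) \<ge> \<kappa> * real (card S) / 8"
    "real (card (diff_set A)) \<le> 2048 * real (card S) / \<kappa> ^ 3"
proof -
  let ?n = "real (card S)"
  define t where "t = \<kappa> * ?n / 16"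
  define bad where "bad = (\<lambda>x y. real (card (shift_inter S (x \<ominus> y))) < t)"
  obtain h where h: "h \<in> diff_set S" "real (card (shift_inter S h)) > \<kappa> * ?n / 4"
    "8 * real (card {(x, y). x \<in> shift_inter S h \<and> y \<in> shift_inter S h \<and> bad x y})
       < real (card (shift_inter S h)) ^ 2"
    unfolding bad_def t_def by (rule popular_shift[OF assms])
  define B where "B = shift_inter S h"
  define b where "b = real (card B)"
  have n0: "?n > 0" using assms by (simp add: card_gt_0_iff)
  have t0: "t > 0" using n0 \<kappa> by (simp add: t_def)
  have BS: "B \<subseteq> S" by (simp add: B_def shift_inter_subset)
  then have finB: "finite B" using assms finite_subset by blast
  have b: "b > \<kappa> * ?n / 4" using h by (simp add: b_def B_def)
  then have b0: "b > 0" using n0 \<kappa> by (meson divide_pos_pos less_trans mult_pos_pos zero_less_numeral)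
  define A where "A = {x \<in> B. real (card {y \<in> B. bad x y}) \<le> b / 4}"
  have AB: "A \<subseteq> B" by (auto simp: A_def)
  then have finA: "finite A" using finB finite_subset by blast
  \<comment> \<open>Each discarded element lies in more than \<open>b / 4\<close> bad pairs, of
    which there are fewer than \<open>b\<^sup>2 / 8\<close>; so less than half of \<open>B\<close>
    is lost.\<close>
  have "real (card (B - A)) * (b / 4) = (\<Sum>x\<in>B - A. b / 4)" by simp
  also have "\<dots> \<le> (\<Sum>x\<in>B - A. real (card {y \<in> B. bad x y}))"
    by (rule sum_mono) (auto simp: A_def)
  also have "\<dots> \<le> (\<Sum>x\<in>B. real (card {y \<in> B. bad x y}))"
    using finB by (intro sum_mono2) auto
  also have "\<dots> = real (card (SIGMA x:B. {y \<in> B. bad x y}))"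
    using finB by (subst card_SigmaI) auto
  also have "(SIGMA x:B. {y \<in> B. bad x y}) = {(x, y). x \<in> B \<and> y \<in> B \<and> bad x y}" by auto
  finally have "real (card (B - A)) * (b / 4) \<le> real (card {(x, y). x \<in> B \<and> y \<in> B \<and> bad x y})" .
  moreover have "8 * real (card {(x, y). x \<in> B \<and> y \<in> B \<and> bad x y}) < b * b"
    using h(3) by (simp add: B_def b_def power2_eq_square)
  ultimately have "real (card (B - A)) * 2 * b < b * b" by simp
  then have "real (card (B - A)) * 2 < b" using b0 mult_right_less_imp_less less_imp_le by blast
  moreover have "real (card (B - A)) = b - real (card A)"
    using card_Diff_subset[OF finA AB] card_mono[OF finB AB] by (simp add: b_def of_nat_diff)
  ultimately have cA: "real (card A) > b / 2" by simp
  have SC: "S \<subseteq> carrier G" by fact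
  define T where "T = (\<lambda>\<delta>. {(a, a', e, e'). a \<in> S \<and> a' \<in> S \<and> e \<in> S \<and> e' \<in> S
       \<and> (a \<ominus> a') \<ominus> (e \<ominus> e') = \<delta>})"
  have finT: "finite (T \<delta>)" for \<delta>
    by (rule finite_subset[of _ "S \<times> S \<times> S \<times> S"]) (use assms in \<open>auto simp: T_def\<close>)
  have cT: "real (card (T \<delta>)) \<ge> b / 2 * t\<^sup>2" if "\<delta> \<in> diff_set A" for \<delta>
  proof -
    obtain x x' where x: "x \<in> A" "x' \<in> A" "\<delta> = x \<ominus> x'" using \<open>\<delta> \<in> diff_set A\<close> by (auto simp: diff_set_def)
    then have xc: "x \<in> carrier G" "x' \<in> carrier G" using AB BS SC by auto
    define Y where "Y = {y \<in> B. \<not> bad x y \<and> \<not> bad x' y}"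
    have finY: "finite Y" using finB by (simp add: Y_def)
    have YC: "Y \<subseteq> carrier G" using BS SC by (auto simp: Y_def)
    have "card B \<le> card (Y \<union> ({y \<in> B. bad x y} \<union> {y \<in> B. bad x' y}))"
      using finB by (intro card_mono) (auto simp: Y_def)
    also have "\<dots> \<le> card Y + (card {y \<in> B. bad x y} + card {y \<in> B. bad x' y})"
      by (meson card_Un_le add_left_mono order_trans)
    finally have "b \<le> real (card Y) + real (card {y \<in> B. bad x y}) + real (card {y \<in> B. bad x' y})"
      by (simp add: b_def)
    then have cY: "real (card Y) \<ge> b / 2" using x by (simp add: A_def)
    let ?P = "SIGMA y:Y. shift_inter S (x \<ominus> y) \<times> shift_inter S (x' \<ominus> y)"
    have "b / 2 * t\<^sup>2 \<le> real (card Y) * t\<^sup>2" using cY by (intro mult_right_mono) auto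
    also have "\<dots> = (\<Sum>y\<in>Y. t * t)" by (simp add: power2_eq_square)
    also have "\<dots> \<le> (\<Sum>y\<in>Y. real (card (shift_inter S (x \<ominus> y))) * real (card (shift_inter S (x' \<ominus> y))))"
      using t0 by (intro sum_mono mult_mono) (auto simp: Y_def bad_def)
    also have "\<dots> = real (card ?P)"
      using finY assms(1) by (subst card_SigmaI) (auto simp: shift_inter_def card_cartesian_product)
    also have "\<dots> \<le> real (card (T \<delta>))"
    proof (rule of_nat_mono, rule card_inj_on_le)
      \<comment> \<open>The partner \<open>y\<close> can be read off from the difference
        \<open>x \<ominus> y\<close> of the first two entries, so distinct \<open>y\<close> give
        distinct quadruples.\<close>
      let ?f = "\<lambda>(y, a, e). (a \<oplus> (x \<ominus> y), a, e \<oplus> (x' \<ominus> y), e)"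
      have dd: "y = z" if "x \<ominus> y = x \<ominus> z" "y \<in> carrier G" "z \<in> carrier G" for y z
      proof (rule a_right_cancelD)
        show "y \<oplus> (x \<ominus> y) = z \<oplus> (x \<ominus> y)"
          using that xc by (metis a_add_diff_cancel)
      qed (use that xc in auto)
      show "inj_on ?f ?P"
      proof (rule inj_onI, clarsimp simp: shift_inter_def)
        fix y a e z
        assume "y \<in> Y" "z \<in> Y" "a \<in> S" "a \<oplus> (x \<ominus> y) = a \<oplus> (x \<ominus> z)"
        then have "x \<ominus> y = x \<ominus> z" "y \<in> carrier G" "z \<in> carrier G"
          using YC SC xc by (auto dest!: a_left_cancelD)
        then show "y = z" using dd by simp
      qed
      show "?f ` ?P \<subseteq> T \<delta>"
      proof (clarsimp simp: shift_inter_def T_def)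
        fix y a e assume m: "y \<in> Y" "a \<in> S" "e \<in> S"
        then have c: "y \<in> carrier G" "a \<in> carrier G" "e \<in> carrier G" using YC SC by auto
        have 1: "a \<oplus> (x \<ominus> y) \<ominus> a = x \<ominus> y" "e \<oplus> (x' \<ominus> y) \<ominus> e = x' \<ominus> y"
          using c xc by (simp_all add: a_minus_eq_iff a_comm)
        have "(x \<ominus> x') \<oplus> (x' \<ominus> y) = (x' \<oplus> (x \<ominus> x')) \<ominus> y"
          using c xc by (simp add: minus_eq a_ac del: a_add_diff_cancel)
        then have "x \<ominus> y \<ominus> (x' \<ominus> y) = x \<ominus> x'"
          using c xc by (subst a_minus_eq_iff) auto
        then show "a \<oplus> (x \<ominus> y) \<ominus> a \<ominus> (e \<oplus> (x' \<ominus> y) \<ominus> e) = \<delta>"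
          using 1 x by simp
      qed
    qed (rule finT)
    finally show ?thesis .
  qed
  have finDA: "finite (diff_set A)" using finA by (rule finite_diff_set)
  have "real (card (diff_set A)) * (b / 2 * t\<^sup>2) = (\<Sum>\<delta>\<in>diff_set A. b / 2 * t\<^sup>2)" by simp
  also have "\<dots> \<le> (\<Sum>\<delta>\<in>diff_set A. real (card (T \<delta>)))" by (intro sum_mono cT)
  also have "\<dots> = real (card (\<Union>\<delta>\<in>diff_set A. T \<delta>))"
    using finDA finT by (subst card_UN_disjoint) (auto simp: T_def)
  also have "\<dots> \<le> real (card (S \<times> S \<times> S \<times> S))"
    using assms(1) by (intro of_nat_mono card_mono) (auto simp: T_def)
  also have "\<dots> = ?n ^ 4" by (simp add: card_cartesian_product power_numeral_reduce)
  finally have "real (card (diff_set A)) * (b / 2 * t\<^sup>2) \<le> ?n ^ 4" .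
  moreover have "\<kappa> * ?n / 4 / 2 * t\<^sup>2 \<le> b / 2 * t\<^sup>2" using b by (intro mult_right_mono) auto
  ultimately have "real (card (diff_set A)) * (\<kappa> * ?n / 4 / 2 * t\<^sup>2) \<le> ?n ^ 4"
    by (meson mult_left_mono of_nat_0_le_iff order_trans)
  \<comment> \<open>Here \<open>2048 = 4 * 2 * 16\<^sup>2\<close>, from the lower bound for
    \<open>b\<close>, the loss of half of \<open>B\<close> and the threshold
    \<open>t\<close>.\<close>
  moreover have "\<kappa> * ?n / 4 / 2 * t\<^sup>2 = \<kappa> ^ 3 * ?n ^ 3 / 2048"
    by (simp add: t_def power2_eq_square power3_eq_cube)
  ultimately have "real (card (diff_set A)) * (\<kappa> ^ 3 * ?n ^ 3 / 2048) \<le> ?n ^ 4"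
    by (simp only:)
  then have "real (card (diff_set A)) * \<kappa> ^ 3 * ?n ^ 3 \<le> 2048 * ?n * ?n ^ 3"
    by (simp add: power_numeral_reduce)
  then have "real (card (diff_set A)) * \<kappa> ^ 3 \<le> 2048 * ?n"
    using n0 by (simp add: mult_le_cancel_right)
  then have "real (card (diff_set A)) \<le> 2048 * ?n / \<kappa> ^ 3"
    using \<kappa>(1) by (simp add: pos_le_divide_eq)
  moreover have "A \<subseteq> S" using AB BS by auto
  moreover have "real (card A) \<ge> \<kappa> * ?n / 8" using b cA by simp
  ultimately show thesis using that by blast
qed

end

section \<open>Cubes\<close>

context abelian_group
begin

text \<open>
  The cube with base point \<open>x\<close> and edges \<open>L = [h\<^sub>1, \<dots>, h\<^sub>d]\<close> has the vertices
  \<open>x + \<Sum>i\<in>I. h\<^sub>i\<close>; those with \<open>d - |I|\<close> even form \<open>half True x L\<close>, the others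
  \<open>half False x L\<close>.
\<close>

primrec half :: "bool \<Rightarrow> 'a \<Rightarrow> 'a list \<Rightarrow> 'a set" where
  "half b x [] = (if b then {x} else {})"
| "half b x (h # L) = (\<lambda>v. v \<oplus> h) ` half b x L \<union> half (\<not> b) x L"

definition verts :: "'a \<Rightarrow> 'a list \<Rightarrow> 'a set" where
  "verts x L = half True x L \<union> half False x L"

lemma verts_Nil [simp]: "verts x [] = {x}"
  by (simp add: verts_def)

lemma verts_Cons [simp]: "verts x (h # L) = (\<lambda>v. v \<oplus> h) ` verts x L \<union> verts x L"
  by (auto simp: verts_def)

lemma half_subset_verts: "half b x L \<subseteq> verts x L"
  by (cases b) (auto simp: verts_def)

lemma base_in_verts: "x \<in> verts x L"
  by (induction L) auto

lemma finite_verts: "finite (verts x L)"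
  by (induction L) auto

lemma finite_half: "finite (half b x L)"
  using finite_verts half_subset_verts finite_subset by metis

lemma card_verts_le: "card (verts x L) \<le> 2 ^ length L"
proof (induction L)
  case (Cons h L)
  have "card (verts x (h # L)) \<le> card ((\<lambda>v. v \<oplus> h) ` verts x L) + card (verts x L)"
    by (simp add: card_Un_le)
  also have "\<dots> \<le> card (verts x L) + card (verts x L)"
    by (simp add: card_image_le finite_verts)
  finally show ?case using Cons by simp
qed simp

lemma verts_carrier: "x \<in> carrier G \<Longrightarrow> set L \<subseteq> carrier G \<Longrightarrow> verts x L \<subseteq> carrier G"
  by (induction L) auto

text \<open>Cubes are counted with base point and ordered edges, and degenerate ones are included;
  this makes the recursion over the dimension exact.\<close>

definition cubes :: "nat \<Rightarrow> 'a set \<Rightarrow> ('a \<times> 'a list) set" where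
  "cubes d A = {(x, L). length L = d \<and> set L \<subseteq> carrier G \<and> verts x L \<subseteq> A}"

lemma cubes_0: "cubes 0 A = (\<lambda>x. (x, [])) ` A"
  by (auto simp: cubes_def)

text \<open>The face spanned by the remaining edges and the single vertex
  \<open>x \<oplus> h\<close> determine the cube, because \<open>h\<close> can be cancelled out of
  that vertex.\<close>

lemma cubes_Suc_embed:
  assumes "A \<subseteq> carrier G"
  shows "inj_on (\<lambda>(x, L). ((x, tl L), x \<oplus> hd L)) (cubes (Suc d) A)"
    and "(\<lambda>(x, L). ((x, tl L), x \<oplus> hd L)) ` cubes (Suc d) A \<subseteq> cubes d A \<times> A"
proof -
  show "inj_on (\<lambda>(x, L). ((x, tl L), x \<oplus> hd L)) (cubes (Suc d) A)"
  proof (rule inj_onI)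
    fix p q assume *: "p \<in> cubes (Suc d) A" "q \<in> cubes (Suc d) A"
      "(\<lambda>(x, L). ((x, tl L), x \<oplus> hd L)) p = (\<lambda>(x, L). ((x, tl L), x \<oplus> hd L)) q"
    obtain x h M where p: "p = (x, h # M)" using *(1) by (auto simp: cubes_def length_Suc_conv)
    obtain h' where q: "q = (x, h' # M)" using *(2,3) p by (auto simp: cubes_def length_Suc_conv)
    have "x \<in> carrier G" "h \<in> carrier G" "h' \<in> carrier G"
      using * assms base_in_verts[of x M] by (auto simp: cubes_def p q)
    then show "p = q" using *(3) p q by (auto dest: a_left_cancelD)
  qed
  show "(\<lambda>(x, L). ((x, tl L), x \<oplus> hd L)) ` cubes (Suc d) A \<subseteq> cubes d A \<times> A"
  proof clarify
    fix x L assume *: "(x, L) \<in> cubes (Suc d) A"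
    then obtain h M where L: "L = h # M" by (cases L) (auto simp: cubes_def)
    show "(x, tl L) \<in> cubes d A \<and> x \<oplus> hd L \<in> A"
      using * base_in_verts[of x M] by (auto simp: cubes_def L)
  qed
qed

lemma finite_cubes: "finite A \<Longrightarrow> A \<subseteq> carrier G \<Longrightarrow> finite (cubes d A)"
proof (induction d)
  case (Suc d)
  then show ?case
    using cubes_Suc_embed[OF Suc.prems(2), of d] by (meson finite_SigmaI inj_on_finite)
qed (simp add: cubes_0)

lemma card_cubes_le: "finite A \<Longrightarrow> A \<subseteq> carrier G \<Longrightarrow> card (cubes d A) \<le> card A ^ (d + 1)"
proof (induction d)
  case 0
  then show ?case by (simp add: cubes_0 card_image inj_on_def)
next
  case (Suc d)
  have "card (cubes (Suc d) A) \<le> card (cubes d A \<times> A)"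
    using cubes_Suc_embed[OF Suc.prems(2), of d] Suc.prems finite_cubes
    by (intro card_inj_on_le) auto
  also have "\<dots> \<le> card A ^ (d + 1) * card A"
    using Suc by (simp add: card_cartesian_product mult.commute)
  finally show ?case by (simp add: mult.commute)
qed

lemma card_cubes_mono:
  "finite B \<Longrightarrow> B \<subseteq> carrier G \<Longrightarrow> A \<subseteq> B \<Longrightarrow> card (cubes d A) \<le> card (cubes d B)"
  by (intro card_mono finite_cubes) (auto simp: cubes_def)

text \<open>A cube inside \<open>shift_inter A h\<close> and its translate by \<open>h\<close> both
  lie in \<open>A\<close>; together they form a cube with the extra edge \<open>h\<close>.\<close>

lemma sum_cubes_shift_inter_le:
  assumes "finite A" "A \<subseteq> carrier G" "finite D" "D \<subseteq> carrier G"
  shows "(\<Sum>h\<in>D. card (cubes d (shift_inter A h))) \<le> card (cubes (Suc d) A)"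
proof -
  have fin: "finite (cubes d (shift_inter A h))" for h
    using assms shift_inter_subset[of A h] finite_subset by (intro finite_cubes) blast+
  have "(\<Sum>h\<in>D. card (cubes d (shift_inter A h))) = card (SIGMA h:D. cubes d (shift_inter A h))"
    using assms fin by (subst card_SigmaI) auto
  also have "\<dots> \<le> card (cubes (Suc d) A)"
  proof (rule card_inj_on_le)
    show "inj_on (\<lambda>(h, x, L). (x, h # L)) (SIGMA h:D. cubes d (shift_inter A h))"
      by (auto simp: inj_on_def)
    show "(\<lambda>(h, x, L). (x, h # L)) ` (SIGMA h:D. cubes d (shift_inter A h)) \<subseteq> cubes (Suc d) A"
      using assms by (auto simp: cubes_def shift_inter_def)
  qed (use assms finite_cubes in blast)
  finally show ?thesis .
qed

end

text \<open>Cauchy--Schwarz iterated: one application passes from \<open>f\<close> to its squares,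
  to which the induction hypothesis applies.\<close>

lemma sum_power_two_power_le:
  fixes f :: "'i \<Rightarrow> real"
  shows "(\<Sum>i\<in>I. f i) ^ (2 ^ d) \<le> real (card I) ^ (2 ^ d - 1) * (\<Sum>i\<in>I. f i ^ (2 ^ d))"
proof (induction d arbitrary: f)
  case (Suc d)
  let ?e = "2 ^ d :: nat"
  have e: "2 ^ Suc d - 1 = ?e + (?e - 1)" by simp
  have "(\<Sum>i\<in>I. f i) ^ (2 ^ Suc d) = ((\<Sum>i\<in>I. f i)\<^sup>2) ^ ?e"
    by (simp add: power_mult)
  also have "\<dots> \<le> (real (card I) * (\<Sum>i\<in>I. (f i)\<^sup>2)) ^ ?e"
    using sum_squared_le_sum_of_squares[of f I] by (intro power_mono) (auto simp: mult.commute)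
  also have "\<dots> = real (card I) ^ ?e * (\<Sum>i\<in>I. (f i)\<^sup>2) ^ ?e"
    by (simp add: power_mult_distrib)
  also have "\<dots> \<le> real (card I) ^ ?e * (real (card I) ^ (?e - 1) * (\<Sum>i\<in>I. ((f i)\<^sup>2) ^ ?e))"
    by (intro mult_left_mono Suc.IH) auto
  also have "\<dots> = real (card I) ^ (2 ^ Suc d - 1) * (\<Sum>i\<in>I. f i ^ (2 ^ Suc d))"
    unfolding e power_add by (simp add: power_mult mult.assoc)
  finally show ?case .
qed simp

lemma Suc_le_two_power: "Suc d \<le> 2 ^ d"
  by (induction d) auto

section \<open>Lower bound for all cubes, upper bound for the bad ones\<close>

context abelian_group
begin

text \<open>The square of \<open>card A\<close> is the sum of the sizes of the sets
  \<open>shift_inter A h\<close>. The power inequality moves the exponent inside, where the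
  induction hypothesis counts cubes in each set. The differences of those sets stay in
  \<open>D\<close>, so a fixed \<open>D\<close> is used throughout the induction.\<close>

lemma card_cubes_ge:
  assumes "finite D" "D \<subseteq> carrier G"
  shows "finite A \<Longrightarrow> A \<subseteq> carrier G \<Longrightarrow> diff_set A \<subseteq> D \<Longrightarrow>
    real (card A) ^ (2 ^ d) \<le> real (card (cubes d A)) * real (card D) ^ (2 ^ d - d - 1)"
proof (induction d arbitrary: A)
  case 0
  then show ?case by (simp add: cubes_0 card_image inj_on_def)
next
  case (Suc d)
  let ?e = "2 ^ d - d - 1 :: nat"
  have e: "2 ^ Suc d - Suc d - 1 = (2 ^ d - 1) + ?e"
    using Suc_le_two_power[of d] by simp
  have sub: "shift_inter A h \<subseteq> A" for h by (rule shift_inter_subset)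
  have "real (card A) ^ (2 ^ Suc d) = (real (card A * card A)) ^ (2 ^ d)"
    by (simp add: power_mult power2_eq_square)
  also have "real (card A * card A) = (\<Sum>h\<in>diff_set A. real (card (shift_inter A h)))"
    by (simp flip: sum_card_shift_inter[OF Suc.prems(1,2)])
  also have "\<dots> ^ 2 ^ d \<le> (\<Sum>h\<in>D. real (card (shift_inter A h))) ^ 2 ^ d"
    using Suc.prems assms by (intro power_mono sum_mono2 sum_nonneg) auto
  also have "\<dots>
      \<le> real (card D) ^ (2 ^ d - 1) * (\<Sum>h\<in>D. real (card (shift_inter A h)) ^ (2 ^ d))"
    by (rule sum_power_two_power_le)
  also have "\<dots> \<le> real (card D) ^ (2 ^ d - 1) *
      (\<Sum>h\<in>D. real (card (cubes d (shift_inter A h))) * real (card D) ^ ?e)"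
  proof (intro mult_left_mono sum_mono Suc.IH)
    fix h show "finite (shift_inter A h)" "shift_inter A h \<subseteq> carrier G" "diff_set (shift_inter A h) \<subseteq> D"
      using Suc.prems sub[of h] diff_set_mono[OF sub, of h] finite_subset by blast+
  qed auto
  also have "\<dots> = real (card D) ^ (2 ^ Suc d - Suc d - 1) *
      real (\<Sum>h\<in>D. card (cubes d (shift_inter A h)))"
    by (simp only: e power_add) (simp add: sum_distrib_left sum_distrib_right mult_ac)
  also have "\<dots> \<le> real (card D) ^ (2 ^ Suc d - Suc d - 1) * real (card (cubes (Suc d) A))"
    using Suc.prems assms by (intro mult_left_mono of_nat_mono sum_cubes_shift_inter_le) auto
  finally show ?case by (simp only: mult.commute)
qed

text \<open>A cube is built edge by edge, starting outside \<open>U\<close> and avoiding the forbidden edges \<open>X\<close>.\<close>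

primrec good_cube :: "'a set \<Rightarrow> ('a \<Rightarrow> 'a list \<Rightarrow> 'a set) \<Rightarrow> 'a \<Rightarrow> 'a list \<Rightarrow> bool" where
  "good_cube U X x [] \<longleftrightarrow> x \<notin> U"
| "good_cube U X x (h # L) \<longleftrightarrow> good_cube U X x L \<and> h \<notin> X x L"

text \<open>A cube is bad because its face is already bad, with at most \<open>card S\<close>
  choices for the next vertex, or because its newest edge is one of at most \<open>M\<close>
  forbidden ones. Each stage thus contributes at most \<open>M * card S ^ d\<close> cubes, one power
  of \<open>card S\<close> below the trivial bound.\<close>

lemma card_not_good_cubes_le:
  assumes S: "finite S" "S \<subseteq> carrier G" and U: "finite U" "card U \<le> M"
    and X: "\<And>x L. (x, L) \<in> cubes (length L) S \<Longrightarrow> good_cube U X x L \<Longrightarrow> length L < d \<Longrightarrow>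
      finite (X x L) \<and> card (X x L) \<le> M"
  shows "card {(x, L) \<in> cubes d S. \<not> good_cube U X x L} \<le> (d + 1) * M * card S ^ d"
  using X
proof (induction d)
  case 0
  have "{(x, L) \<in> cubes 0 S. \<not> good_cube U X x L} \<subseteq> (\<lambda>x. (x, [])) ` U"
    by (auto simp: cubes_0)
  then have "card {(x, L) \<in> cubes 0 S. \<not> good_cube U X x L} \<le> card U"
    using U(1) surj_card_le by blast
  also have "card U \<le> M" by fact
  finally show ?case by simp
next
  case (Suc d)
  let ?bad = "\<lambda>d. {(x, L) \<in> cubes d S. \<not> good_cube U X x L}"
  let ?good = "{(x, L) \<in> cubes d S. good_cube U X x L}"
  let ?f = "\<lambda>(x, L). ((x, tl L), x \<oplus> hd L)"
  \<comment> \<open>The two parts encode the two reasons for being bad: a bad face, or a good face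
    with a forbidden last edge.\<close>
  let ?T = "?bad d \<times> S \<union> (SIGMA p:?good. (\<lambda>h. fst p \<oplus> h) ` X (fst p) (snd p))"
  have finc: "finite (cubes d S)" for d using S finite_cubes by blast
  have fing: "finite ?good" by (rule finite_subset[OF _ finc[of d]]) auto
  have X: "finite (X x L) \<and> card (X x L) \<le> M" if "(x, L) \<in> ?good" for x L
    using Suc.prems[of x L] that by (auto simp: cubes_def)
  have finX: "finite ((\<lambda>h. fst p \<oplus> h) ` X (fst p) (snd p))" if "p \<in> ?good" for p
    using X[of "fst p" "snd p"] that by auto
  have finB: "finite (?bad d \<times> S)"
    using S by (intro finite_SigmaI finite_subset[OF _ finc[of d]]) auto
  have finG: "finite (SIGMA p:?good. (\<lambda>h. fst p \<oplus> h) ` X (fst p) (snd p))"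
    by (rule finite_SigmaI[OF fing finX])
  have "card (?bad (Suc d)) \<le> card ?T"
  proof (rule card_inj_on_le)
    show "inj_on ?f (?bad (Suc d))"
      by (rule inj_on_subset[OF cubes_Suc_embed(1)[OF S(2), of d]]) auto
    show "finite ?T" using finB finG by blast
    show "?f ` ?bad (Suc d) \<subseteq> ?T"
    proof (rule image_subsetI)
      fix p assume p: "p \<in> ?bad (Suc d)"
      then obtain x h L where L: "p = (x, h # L)" by (auto simp: cubes_def length_Suc_conv)
      have "((x, L), x \<oplus> h) \<in> cubes d S \<times> S"
        using cubes_Suc_embed(2)[OF S(2), of d] p by (force simp: L)
      then show "?f p \<in> ?T" using p by (auto simp: L)
    qed
  qed
  also have "\<dots> \<le> card (?bad d \<times> S) + card (SIGMA p:?good. (\<lambda>h. fst p \<oplus> h) ` X (fst p) (snd p))"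
    by (rule card_Un_le)
  also have "card (?bad d \<times> S) \<le> (d + 1) * M * card S ^ d * card S"
    using Suc.IH Suc.prems by (simp add: card_cartesian_product)
  also have "card (SIGMA p:?good. (\<lambda>h. fst p \<oplus> h) ` X (fst p) (snd p))
      = (\<Sum>p\<in>?good. card ((\<lambda>h. fst p \<oplus> h) ` X (fst p) (snd p)))"
    using fing finX by (intro card_SigmaI) auto
  also have "\<dots> \<le> (\<Sum>p\<in>?good. M)"
  proof (rule sum_mono)
    fix p assume p: "p \<in> ?good"
    then show "card ((\<lambda>h. fst p \<oplus> h) ` X (fst p) (snd p)) \<le> M"
      using X[of "fst p" "snd p"] by (auto intro: order_trans[OF card_image_le])
  qed
  also have "\<dots> = card ?good * M" by simp
  also have "card ?good \<le> card (cubes d S)"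
    by (intro card_mono finc) auto
  also have "card (cubes d S) \<le> card S ^ (d + 1)" by (rule card_cubes_le[OF S])
  finally show ?case by (simp add: algebra_simps)
qed

end

section \<open>Power sums over the halves of a cube\<close>

context abelian_group
begin

text \<open>For \<open>x\<close> in the carrier this expresses that all \<open>2 ^ length L\<close>
  vertices are distinct, in the form needed to add one edge at a time.\<close>

primrec proper_cube :: "'a \<Rightarrow> 'a list \<Rightarrow> bool" where
  "proper_cube x [] \<longleftrightarrow> True"
| "proper_cube x (h # L) \<longleftrightarrow>
     proper_cube x L \<and> h \<in> carrier G \<and> (\<lambda>v. v \<oplus> h) ` verts x L \<inter> verts x L = {}"

lemma proper_cube_carrier: "proper_cube x L \<Longrightarrow> set L \<subseteq> carrier G"
  by (induction L) auto

lemma proper_cube_edge_nonzero: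
  "x \<in> carrier G \<Longrightarrow> proper_cube x (h # L) \<Longrightarrow> h \<noteq> \<zero>"
  using base_in_verts[of x L] by force

lemma half_disjoint: "x \<in> carrier G \<Longrightarrow> proper_cube x L \<Longrightarrow> half b x L \<inter> half (\<not> b) x L = {}"
proof (induction L arbitrary: b)
  case (Cons h L)
  have h: "h \<in> carrier G" and d: "(\<lambda>v. v \<oplus> h) ` verts x L \<inter> verts x L = {}" and p: "proper_cube x L"
    using Cons.prems by auto
  have "verts x L \<subseteq> carrier G" using Cons.prems(1) proper_cube_carrier[OF p] by (rule verts_carrier)
  then have "inj_on (\<lambda>v. v \<oplus> h) (verts x L)" using h by (rule inj_on_translate[rotated])
  then have "(\<lambda>v. v \<oplus> h) ` half b x L \<inter> (\<lambda>v. v \<oplus> h) ` half (\<not> b) x L = {}"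
    using Cons.IH[OF Cons.prems(1) p, of b] half_subset_verts
    by (metis image_empty inj_on_image_Int)
  moreover have "(\<lambda>v. v \<oplus> h) ` half b' x L \<inter> half b'' x L = {}" for b' b''
    using d half_subset_verts by blast
  moreover from this have "half b'' x L \<inter> (\<lambda>v. v \<oplus> h) ` half b' x L = {}" for b' b''
    by (simp add: inf_commute)
  ultimately show ?case
    using Cons.IH[OF Cons.prems(1) p, of b] by (simp add: Int_Un_distrib Int_Un_distrib2 inf_commute)
qed simp

lemma half_Cons_disjoint:
  "proper_cube x (h # L) \<Longrightarrow> (\<lambda>v. v \<oplus> h) ` half b x L \<inter> half b' x L = {}"
  using half_subset_verts[of b x L] half_subset_verts[of b' x L] by auto

lemma half_carrier: "x \<in> carrier G \<Longrightarrow> set L \<subseteq> carrier G \<Longrightarrow> half b x L \<subseteq> carrier G"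
  using half_subset_verts verts_carrier by blast

lemma card_half_add: "x \<in> carrier G \<Longrightarrow> proper_cube x L \<Longrightarrow>
    card (half b x L) + card (half (\<not> b) x L) = 2 ^ length L"
proof (induction L arbitrary: b)
  case (Cons h L)
  have h: "h \<in> carrier G" and p: "proper_cube x L" using Cons.prems by auto
  have "card (half b x (h # L)) = card (half b x L) + card (half (\<not> b) x L)" for b
    using half_Cons_disjoint[OF Cons.prems(2), of b "\<not> b"] finite_half
      card_image[OF inj_on_translate[OF h half_carrier[OF Cons.prems(1) proper_cube_carrier[OF p]]]]
    by (simp add: card_Un_disjoint)
  then show ?case using Cons.IH[OF Cons.prems(1) p, of b] by (simp del: half.simps)
qed simp

text \<open>The first edge makes each half the disjoint union of a translate of one half of the face
  and the other half of the face. Dimension 0 is excluded, since there the halves have sizes 1 and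
  0.\<close>

lemma card_half:
  assumes "x \<in> carrier G" "proper_cube x L" "length L = Suc d"
  shows "card (half b x L) = 2 ^ d"
proof -
  obtain h M where L: "L = h # M" "length M = d" using assms(3) by (cases L) auto
  have h: "h \<in> carrier G" and p: "proper_cube x M" using assms(2) L by auto
  have "card (half b x L) = card (half b x M) + card (half (\<not> b) x M)"
    using half_Cons_disjoint[OF assms(2)[unfolded L], of b "\<not> b"] finite_half
      card_image[OF inj_on_translate[OF h half_carrier[OF assms(1) proper_cube_carrier[OF p]]]]
    by (simp add: card_Un_disjoint L)
  then show ?thesis using card_half_add[OF assms(1) p] L by simp
qed

section \<open>Alternating sums over cubes as iterated differences\<close>

lemma finsum_a_minus:
  assumes "f \<in> A \<rightarrow> carrier G" "g \<in> A \<rightarrow> carrier G"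
  shows "(\<Oplus>x\<in>A. f x \<ominus> g x) = finsum G f A \<ominus> finsum G g A"
proof -
  have c: "(\<lambda>x. f x \<ominus> g x) \<in> A \<rightarrow> carrier G" using assms by auto
  have "(\<Oplus>x\<in>A. f x \<ominus> g x) \<oplus> finsum G g A = (\<Oplus>x\<in>A. (f x \<ominus> g x) \<oplus> g x)"
    by (rule finsum_addf[symmetric, OF c assms(2)])
  also have "\<dots> = finsum G f A"
  proof (rule finsum_cong')
    fix i assume "i \<in> A"
    then have "f i \<in> carrier G" "g i \<in> carrier G" using assms by auto
    then show "f i \<ominus> g i \<oplus> g i = f i" by (simp add: a_comm)
  qed (use assms in auto)
  finally show ?thesis using assms c finsum_closed by (metis a_minus_eq_iff)
qed

definition fdiff :: "'a \<Rightarrow> ('a \<Rightarrow> 'a) \<Rightarrow> 'a \<Rightarrow> 'a" where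
  "fdiff h f x = f (x \<oplus> h) \<ominus> f x"

text \<open>The sign of the vertex \<open>x + \<Sum>i\<in>I. h_i\<close> is
  \<open>(-1) ^ (d - card I)\<close>, so for a proper cube this is the iterated difference of
  \<open>f\<close> at \<open>x\<close> along the edges.\<close>

definition altsum :: "('a \<Rightarrow> 'a) \<Rightarrow> 'a \<Rightarrow> 'a list \<Rightarrow> 'a" where
  "altsum f x L = finsum G f (half True x L) \<ominus> finsum G f (half False x L)"

lemma fdiff_closed:
  "f \<in> carrier G \<rightarrow> carrier G \<Longrightarrow> h \<in> carrier G \<Longrightarrow> fdiff h f \<in> carrier G \<rightarrow> carrier G"
  by (auto simp: fdiff_def Pi_iff)

lemma finsum_half_closed:
  assumes "x \<in> carrier G" "set L \<subseteq> carrier G" "f \<in> carrier G \<rightarrow> carrier G"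
  shows "finsum G f (half b x L) \<in> carrier G"
  using assms half_carrier[OF assms(1,2)] by (intro finsum_closed) blast

lemma altsum_Nil:
  "x \<in> carrier G \<Longrightarrow> f \<in> carrier G \<rightarrow> carrier G \<Longrightarrow> altsum f x [] = f x"
  by (auto simp: altsum_def finsum_singleton minus_eq Pi_iff)

lemma altsum_cong:
  assumes "x \<in> carrier G" "set L \<subseteq> carrier G" "g \<in> carrier G \<rightarrow> carrier G"
    and "\<And>y. y \<in> carrier G \<Longrightarrow> f y = g y"
  shows "altsum f x L = altsum g x L"
  using half_carrier[OF assms(1,2)] assms(3,4) unfolding altsum_def
  by (intro arg_cong2[of _ _ _ _ "a_minus G"] finsum_cong') blast+

lemma altsum_add:
  assumes x: "x \<in> carrier G" "set L \<subseteq> carrier G"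
    and f: "f \<in> carrier G \<rightarrow> carrier G" and g: "g \<in> carrier G \<rightarrow> carrier G"
  shows "altsum (\<lambda>y. f y \<oplus> g y) x L = altsum f x L \<oplus> altsum g x L"
proof -
  have "finsum G (\<lambda>y. f y \<oplus> g y) (half b x L) = finsum G f (half b x L) \<oplus> finsum G g (half b x L)" for b
    using half_carrier[OF x] f g by (intro finsum_addf) blast+
  then show ?thesis
    using finsum_half_closed[OF x f] finsum_half_closed[OF x g]
    by (simp add: altsum_def minus_eq minus_add a_ac)
qed

text \<open>The recursion for \<open>half\<close> puts \<open>y \<oplus> h\<close> and
  \<open>y\<close> into opposite halves, so the terms pair up to \<open>fdiff h f y\<close>.
  Properness makes the unions disjoint, which allows the sums to be split.\<close>

lemma altsum_Cons:
  assumes x: "x \<in> carrier G" "proper_cube x (h # L)" and f: "f \<in> carrier G \<rightarrow> carrier G"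
  shows "altsum f x (h # L) = altsum (fdiff h f) x L"
proof -
  have h: "h \<in> carrier G" and p: "proper_cube x L" using x by auto
  note hc = half_carrier[OF x(1) proper_cube_carrier[OF p]]
  have fh: "(\<lambda>y. f (y \<oplus> h)) \<in> carrier G \<rightarrow> carrier G" using f h by auto
  have 1: "finsum G f (half b x (h # L))
      = finsum G (\<lambda>y. f (y \<oplus> h)) (half b x L) \<oplus> finsum G f (half (\<not> b) x L)" for b
  proof -
    have "finsum G f (half b x (h # L))
        = finsum G f ((\<lambda>v. v \<oplus> h) ` half b x L) \<oplus> finsum G f (half (\<not> b) x L)"
      unfolding half.simps
    proof (rule finsum_Un_disjoint)
      show "f \<in> (\<lambda>v. v \<oplus> h) ` half b x L \<rightarrow> carrier G" using fh hc by blast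
      show "f \<in> half (\<not> b) x L \<rightarrow> carrier G" using f hc by blast
    qed (use half_Cons_disjoint[OF x(2)] finite_half in auto)
    also have "finsum G f ((\<lambda>v. v \<oplus> h) ` half b x L) = finsum G (\<lambda>y. f (y \<oplus> h)) (half b x L)"
      using fh hc h by (intro finsum_reindex inj_on_translate) blast+
    finally show ?thesis .
  qed
  have 2: "finsum G (fdiff h f) (half b x L)
      = finsum G (\<lambda>y. f (y \<oplus> h)) (half b x L) \<ominus> finsum G f (half b x L)" for b
    unfolding fdiff_def using f fh hc by (intro finsum_a_minus) blast+
  have c: "finsum G (\<lambda>y. f (y \<oplus> h)) (half b x L) \<in> carrier G" "finsum G f (half b x L) \<in> carrier G" for b
    using finsum_half_closed[OF x(1) proper_cube_carrier[OF p]] f fh by auto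
  show ?thesis
    using c[of True] c[of False] unfolding altsum_def 1 2
    by (simp add: minus_eq minus_add a_ac)
qed

text \<open>\<open>deg_less n f\<close>: the function \<open>f\<close> is a polynomial map of degree less than \<open>n\<close>.\<close>

primrec deg_less :: "nat \<Rightarrow> ('a \<Rightarrow> 'a) \<Rightarrow> bool" where
  "deg_less 0 f \<longleftrightarrow> (\<forall>x\<in>carrier G. f x = \<zero>)"
| "deg_less (Suc n) f \<longleftrightarrow> (\<forall>h\<in>carrier G. deg_less n (fdiff h f))"

text \<open>Every edge takes one difference and lowers the degree bound by one, until
  \<open>deg_less 0\<close> is reached.\<close>

lemma altsum_eq_zero:
  assumes "x \<in> carrier G"
  shows "proper_cube x L \<Longrightarrow> f \<in> carrier G \<rightarrow> carrier G \<Longrightarrow> deg_less (length L) f \<Longrightarrow> altsum f x L = \<zero>"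
proof (induction L arbitrary: f)
  case Nil
  then show ?case using assms by (simp add: altsum_Nil)
next
  case (Cons h L)
  then show ?case using assms by (simp add: altsum_Cons fdiff_closed)
qed

lemma deg_less_cong:
  "(\<And>x. x \<in> carrier G \<Longrightarrow> f x = g x) \<Longrightarrow> deg_less n f = deg_less n g"
proof (induction n arbitrary: f g)
  case (Suc n)
  have "deg_less n (fdiff h f) = deg_less n (fdiff h g)" if "h \<in> carrier G" for h
    by (rule Suc.IH) (simp add: fdiff_def Suc.prems that)
  then show ?case by simp
qed simp

lemma deg_less_zero: "deg_less n (\<lambda>_. \<zero>)"
proof (induction n)
  case (Suc n)
  then show ?case by (simp add: fdiff_def[abs_def])
qed simp

lemma deg_less_mono1: "deg_less n f \<Longrightarrow> deg_less (Suc n) f"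
proof (induction n arbitrary: f)
  case 0
  then show ?case by (simp add: fdiff_def)
next
  case (Suc n)
  then show ?case by (metis deg_less.simps(2))
qed

lemma deg_less_mono: "m \<le> n \<Longrightarrow> deg_less m f \<Longrightarrow> deg_less n f"
  by (induction rule: dec_induct) (auto intro: deg_less_mono1 simp del: deg_less.simps)

lemma deg_less_const: "c \<in> carrier G \<Longrightarrow> deg_less (Suc 0) (\<lambda>_. c)"
  by (simp add: fdiff_def)

lemma deg_less_add:
  "f \<in> carrier G \<rightarrow> carrier G \<Longrightarrow> g \<in> carrier G \<rightarrow> carrier G \<Longrightarrow> deg_less n f \<Longrightarrow> deg_less n g \<Longrightarrow>
    deg_less n (\<lambda>x. f x \<oplus> g x)"
proof (induction n arbitrary: f g)
  case (Suc n)
  have "deg_less n (fdiff h (\<lambda>x. f x \<oplus> g x))" if h: "h \<in> carrier G" for h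
  proof -
    have "deg_less n (\<lambda>x. fdiff h f x \<oplus> fdiff h g x)"
      using Suc h by (intro Suc.IH fdiff_closed) auto
    also have "?this \<longleftrightarrow> ?thesis"
    proof (rule deg_less_cong)
      fix x assume x: "x \<in> carrier G"
      then have "f x \<in> carrier G" "g x \<in> carrier G" "f (x \<oplus> h) \<in> carrier G" "g (x \<oplus> h) \<in> carrier G"
        using Suc.prems h by auto
      then show "fdiff h f x \<oplus> fdiff h g x = fdiff h (\<lambda>x. f x \<oplus> g x) x"
        by (simp add: fdiff_def minus_eq minus_add a_ac)
    qed
    finally show ?thesis .
  qed
  then show ?case by simp
qed simp

lemma deg_less_shift: "c \<in> carrier G \<Longrightarrow> deg_less n f \<Longrightarrow> deg_less n (\<lambda>x. f (x \<oplus> c))"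
proof (induction n arbitrary: f)
  case (Suc n)
  have "deg_less n (fdiff h (\<lambda>x. f (x \<oplus> c)))" if h: "h \<in> carrier G" for h
  proof -
    have "deg_less n (\<lambda>x. fdiff h f (x \<oplus> c))" using Suc h by auto
    also have "?this \<longleftrightarrow> ?thesis"
      by (rule deg_less_cong) (use Suc.prems h in \<open>simp add: fdiff_def a_ac\<close>)
    finally show ?thesis .
  qed
  then show ?case by simp
qed simp

end

section \<open>Degrees of power maps without commutativity or identity\<close>

context nonunital_ring
begin

lemma mult_zero_left: "x \<in> carrier R \<Longrightarrow> \<zero> \<otimes> x = \<zero>"
  using l_distr[of \<zero> \<zero> x] m_closed[of \<zero> x] by (metis a_left_cancelD r_zero zero_closed)

lemma mult_minus_left:
  assumes "x \<in> carrier R" "y \<in> carrier R" "z \<in> carrier R"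
  shows "(x \<ominus> y) \<otimes> z = x \<otimes> z \<ominus> y \<otimes> z"
proof -
  have "x \<otimes> z = (x \<ominus> y \<oplus> y) \<otimes> z" using assms by (simp add: a_comm)
  also have "\<dots> = (x \<ominus> y) \<otimes> z \<oplus> y \<otimes> z" using assms by (simp add: l_distr)
  finally show ?thesis using assms by (metis a_minus_eq_iff m_closed minus_closed)
qed

lemma deg_less_mult_const:
  "f \<in> carrier R \<rightarrow> carrier R \<Longrightarrow> c \<in> carrier R \<Longrightarrow> deg_less n f \<Longrightarrow> deg_less n (\<lambda>x. f x \<otimes> c)"
proof (induction n arbitrary: f)
  case 0
  then show ?case by (simp add: mult_zero_left)
next
  case (Suc n)
  have "deg_less n (fdiff h (\<lambda>x. f x \<otimes> c))" if h: "h \<in> carrier R" for h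
  proof -
    have "deg_less n (\<lambda>x. fdiff h f x \<otimes> c)" using Suc h by (intro Suc.IH fdiff_closed) auto
    also have "?this \<longleftrightarrow> ?thesis"
      by (rule deg_less_cong) (use Suc.prems h in \<open>simp add: fdiff_def mult_minus_left Pi_iff\<close>)
    finally show ?thesis .
  qed
  then show ?case by simp
qed

text \<open>Product rule for differences; the order of the factors is kept, as the ring need not be
  commutative.\<close>

lemma fdiff_mult_id:
  assumes "f \<in> carrier R \<rightarrow> carrier R" "h \<in> carrier R" "x \<in> carrier R"
  shows "fdiff h (\<lambda>x. f x \<otimes> x) x = fdiff h f x \<otimes> x \<oplus> f (x \<oplus> h) \<otimes> h"
proof -
  have c: "f x \<in> carrier R" "f (x \<oplus> h) \<in> carrier R" using assms by auto
  then have d: "fdiff h f x \<in> carrier R" by (simp add: fdiff_def)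
  have "fdiff h f x \<otimes> x \<oplus> f (x \<oplus> h) \<otimes> h \<oplus> f x \<otimes> x
      = (fdiff h f x \<oplus> f x) \<otimes> x \<oplus> f (x \<oplus> h) \<otimes> h"
    using assms c d by (simp add: l_distr m_closed a_ac)
  also have "fdiff h f x \<oplus> f x = f (x \<oplus> h)" using c by (simp add: fdiff_def a_comm)
  also have "f (x \<oplus> h) \<otimes> x \<oplus> f (x \<oplus> h) \<otimes> h = f (x \<oplus> h) \<otimes> (x \<oplus> h)"
    using assms c by (simp add: r_distr)
  finally show ?thesis
    using assms c d m_closed by (simp add: fdiff_def[of h "\<lambda>x. f x \<otimes> x"] a_minus_eq_iff)
qed

text \<open>By the product rule a difference of \<open>f x \<otimes> x\<close> is the same kind of
  product for \<open>fdiff h f\<close>, covered by induction, plus a translate of \<open>f\<close>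
  times a constant.\<close>

lemma deg_less_mult_id:
  "f \<in> carrier R \<rightarrow> carrier R \<Longrightarrow> deg_less n f \<Longrightarrow> deg_less (Suc n) (\<lambda>x. f x \<otimes> x)"
proof (induction n arbitrary: f)
  case 0
  then show ?case by (simp add: mult_zero_left fdiff_def)
next
  case (Suc n)
  have "deg_less (Suc n) (fdiff h (\<lambda>x. f x \<otimes> x))" if h: "h \<in> carrier R" for h
  proof -
    have "deg_less (Suc n) (\<lambda>x. fdiff h f x \<otimes> x \<oplus> f (x \<oplus> h) \<otimes> h)"
    proof (rule deg_less_add)
      show "deg_less (Suc n) (\<lambda>x. fdiff h f x \<otimes> x)"
        using Suc h by (intro Suc.IH fdiff_closed) auto
      show "deg_less (Suc n) (\<lambda>x. f (x \<oplus> h) \<otimes> h)"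
        using Suc.prems h by (intro deg_less_mult_const deg_less_shift) auto
    qed (use Suc.prems h fdiff_closed m_closed in \<open>auto simp: Pi_iff\<close>)
    also have "?this \<longleftrightarrow> ?thesis"
      by (rule deg_less_cong) (use Suc.prems h in \<open>simp add: fdiff_mult_id\<close>)
    finally show ?thesis .
  qed
  then show ?case by (simp only: deg_less.simps(2)) blast
qed

lemma pos_pow_closed:
  assumes "x \<in> carrier R" "j \<ge> 1"
  shows "pos_pow R x j \<in> carrier R"
  using assms(2)
proof (induction j rule: dec_induct)
  case base
  then show ?case using assms(1) by (simp add: pos_pow_def)
next
  case (step j)
  then show ?case using assms(1) by (simp add: pos_pow_Suc m_closed)
qed

lemma deg_less_pos_pow: "j \<ge> 1 \<Longrightarrow> deg_less (Suc j) (\<lambda>x. pos_pow R x j)"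
proof (induction j rule: dec_induct)
  case base
  have "fdiff h (\<lambda>x. pos_pow R x 1) x = h" if "h \<in> carrier R" "x \<in> carrier R" for h x
    using that by (simp add: fdiff_def pos_pow_def a_minus_eq_iff a_comm)
  then have "deg_less (Suc 0) (fdiff h (\<lambda>x. pos_pow R x 1))" if "h \<in> carrier R" for h
    using deg_less_const[OF that] that deg_less_cong[of "\<lambda>_. h"] by metis
  then show ?case by simp
next
  case (step j)
  then show ?case
    using deg_less_mult_id[of "\<lambda>x. pos_pow R x j" "Suc j"] pos_pow_closed by (simp add: pos_pow_Suc)
qed

text \<open>There are more edges than the degree \<open>j\<close>, so the iterated difference of the
  power map vanishes.\<close>

lemma power_sum_half_eq:
  assumes x: "x \<in> carrier R" "proper_cube x L" and j: "1 \<le> j" "j < length L"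
  shows "power_sum R j (half True x L) = power_sum R j (half False x L)"
proof -
  have cl: "(\<lambda>x. pos_pow R x j) \<in> carrier R \<rightarrow> carrier R" using j pos_pow_closed by auto
  have "altsum (\<lambda>x. pos_pow R x j) x L = \<zero>"
    using x cl j by (intro altsum_eq_zero deg_less_mono[OF _ deg_less_pos_pow]) auto
  then show ?thesis
    using finsum_half_closed[OF x(1) proper_cube_carrier[OF x(2)] cl]
    by (simp add: altsum_def power_sum_def a_minus_eq_iff)
qed

end

section \<open>The top-degree difference in an integral domain\<close>

context "domain"
begin

lemma deg_less_pow: "deg_less (Suc n) (\<lambda>x. x [^] n)"
proof (induction n)
  case 0
  then show ?case using deg_less_const[of \<one>] by simp
next
  case (Suc n)
  interpret nonunital_ring R by (rule is_nonunital_ring)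
  show ?case using deg_less_mult_id[OF _ Suc] by simp
qed

text \<open>The leading term of the binomial expansion. All that matters about the remainder
  \<open>g\<close> is its degree, since \<open>n\<close> further differences annihilate it.\<close>

lemma fdiff_pow:
  assumes h: "h \<in> carrier R"
  shows "\<exists>g\<in>carrier R \<rightarrow> carrier R. deg_less n g \<and>
    (\<forall>x\<in>carrier R. fdiff h (\<lambda>x. x [^] Suc n) x = x [^] n \<otimes> ([Suc n] \<cdot> \<one> \<otimes> h) \<oplus> g x)"
proof (induction n)
  case 0
  have "fdiff h (\<lambda>x. x [^] Suc 0) x = h" if "x \<in> carrier R" for x
    using that h by (simp add: fdiff_def a_minus_eq_iff a_comm)
  then show ?case using h by (intro bexI[of _ "\<lambda>_. \<zero>"]) (auto simp: deg_less_zero)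
next
  case (Suc n)
  interpret nonunital_ring R by (rule is_nonunital_ring)
  obtain g where g: "g \<in> carrier R \<rightarrow> carrier R" "deg_less n g"
    and eq: "\<And>x. x \<in> carrier R \<Longrightarrow>
      fdiff h (\<lambda>x. x [^] Suc n) x = x [^] n \<otimes> ([Suc n] \<cdot> \<one> \<otimes> h) \<oplus> g x"
    using Suc by blast
  define e where "e = [Suc n] \<cdot> \<one>"
  have e: "e \<in> carrier R" "[Suc (Suc n)] \<cdot> \<one> = e \<oplus> \<one>" by (simp_all add: e_def)
  \<comment> \<open>Expanding the product rule for \<open>x [^] Suc n \<otimes> x\<close> gives
    these three terms besides the leading one, to which \<open>p \<otimes> x \<otimes> h\<close>
    contributes the additional \<open>\<one>\<close>.\<close>
  define g' where "g' = (\<lambda>x. g x \<otimes> x \<oplus> (x [^] n \<otimes> (e \<otimes> h \<otimes> h) \<oplus> g x \<otimes> h))"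
  have "deg_less (Suc n) g'" unfolding g'_def
  proof (intro deg_less_add)
    show "deg_less (Suc n) (\<lambda>x. g x \<otimes> x)" using g by (rule deg_less_mult_id)
    show "deg_less (Suc n) (\<lambda>x. x [^] n \<otimes> (e \<otimes> h \<otimes> h))"
      using e h by (intro deg_less_mult_const deg_less_pow) auto
    show "deg_less (Suc n) (\<lambda>x. g x \<otimes> h)"
      using g h by (intro deg_less_mult_const deg_less_mono1)
  qed (use g e h in \<open>auto simp: Pi_iff\<close>)
  moreover have "g' \<in> carrier R \<rightarrow> carrier R"
    using g e h by (auto simp: g'_def Pi_iff)
  moreover have "fdiff h (\<lambda>x. x [^] Suc (Suc n)) x
      = x [^] Suc n \<otimes> ([Suc (Suc n)] \<cdot> \<one> \<otimes> h) \<oplus> g' x" if x: "x \<in> carrier R" for x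
  proof -
    have gx: "g x \<in> carrier R" using g x by auto
    define p where "p = x [^] n"
    have p: "p \<in> carrier R" using x by (simp add: p_def)
    have f: "(x \<oplus> h) [^] Suc n = (p \<otimes> (e \<otimes> h) \<oplus> g x) \<oplus> p \<otimes> x"
      using eq[OF x] x h p gx e by (simp add: fdiff_def a_minus_eq_iff e_def p_def)
    have "fdiff h (\<lambda>x. x [^] Suc (Suc n)) x
        = (p \<otimes> (e \<otimes> h) \<oplus> g x) \<otimes> x \<oplus> ((p \<otimes> (e \<otimes> h) \<oplus> g x) \<oplus> p \<otimes> x) \<otimes> h"
      using fdiff_mult_id[of "\<lambda>x. x [^] Suc n" h x] eq[OF x] x h
      by (simp only: f nat_pow_Suc[symmetric] flip: e_def p_def) auto
    also have "\<dots> = (p \<otimes> x) \<otimes> ((e \<oplus> \<one>) \<otimes> h) \<oplus> g' x"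
      unfolding g'_def p_def[symmetric] using p e gx x h by algebra
    finally show ?thesis by (simp only: p_def e(2) nat_pow_Suc)
  qed
  ultimately show ?case by blast
qed

text \<open>This is \<open>d!\<close> times the product of the edges, where
  \<open>d = length L\<close>.\<close>

primrec cube_top :: "'a list \<Rightarrow> 'a" where
  "cube_top [] = \<one>"
| "cube_top (h # L) = [Suc (length L)] \<cdot> \<one> \<otimes> h \<otimes> cube_top L"

lemma cube_top_closed: "set L \<subseteq> carrier R \<Longrightarrow> cube_top L \<in> carrier R"
  by (induction L) auto

text \<open>The difference along \<open>h\<close> leaves a multiple of the next lower power and a
  remainder that the other edges annihilate. The factor \<open>c\<close> accumulates the
  coefficients in the induction.\<close>

lemma altsum_pow:
  assumes x: "x \<in> carrier R"
  shows "proper_cube x L \<Longrightarrow> c \<in> carrier R \<Longrightarrow>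
    altsum (\<lambda>x. x [^] length L \<otimes> c) x L = cube_top L \<otimes> c"
proof (induction L arbitrary: c)
  case Nil
  then show ?case using x by (simp add: altsum_Nil)
next
  case (Cons h L)
  interpret nonunital_ring R by (rule is_nonunital_ring)
  let ?n = "length L"
  let ?e = "[Suc ?n] \<cdot> \<one>"
  have h: "h \<in> carrier R" and p: "proper_cube x L" using Cons.prems by auto
  note L = proper_cube_carrier[OF p]
  obtain g where g: "g \<in> carrier R \<rightarrow> carrier R" "deg_less ?n g"
    and eq: "\<And>x. x \<in> carrier R \<Longrightarrow>
      fdiff h (\<lambda>x. x [^] Suc ?n) x = x [^] ?n \<otimes> (?e \<otimes> h) \<oplus> g x"
    using fdiff_pow[OF h] by blast
  have gc: "(\<lambda>x. g x \<otimes> c) \<in> carrier R \<rightarrow> carrier R" using g Cons.prems by auto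
  have "altsum (\<lambda>x. x [^] length (h # L) \<otimes> c) x (h # L)
      = altsum (fdiff h (\<lambda>x. x [^] Suc ?n \<otimes> c)) x L"
    using x Cons.prems by (subst altsum_Cons) auto
  also have "\<dots> = altsum (\<lambda>x. x [^] ?n \<otimes> (?e \<otimes> h \<otimes> c) \<oplus> g x \<otimes> c) x L"
  proof (rule altsum_cong[OF x L])
    fix y assume y: "y \<in> carrier R"
    have "fdiff h (\<lambda>x. x [^] Suc ?n \<otimes> c) y = fdiff h (\<lambda>x. x [^] Suc ?n) y \<otimes> c"
      using y h Cons.prems by (simp add: fdiff_def mult_minus_left)
    also have "\<dots> = y [^] ?n \<otimes> (?e \<otimes> h \<otimes> c) \<oplus> g y \<otimes> c"
    proof -
      have "g y \<in> carrier R" using g y by auto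
      then show ?thesis
        using y h Cons.prems unfolding eq[OF y] by (simp add: l_distr m_assoc)
    qed
    finally show "fdiff h (\<lambda>x. x [^] Suc ?n \<otimes> c) y = y [^] ?n \<otimes> (?e \<otimes> h \<otimes> c) \<oplus> g y \<otimes> c" .
  qed (use h g Cons.prems in \<open>auto simp: Pi_iff\<close>)
  also have "\<dots> = altsum (\<lambda>x. x [^] ?n \<otimes> (?e \<otimes> h \<otimes> c)) x L \<oplus> altsum (\<lambda>x. g x \<otimes> c) x L"
    using h Cons.prems gc by (intro altsum_add[OF x L]) auto
  also have "altsum (\<lambda>x. g x \<otimes> c) x L = \<zero>"
    using g Cons.prems gc by (intro altsum_eq_zero[OF x p] deg_less_mult_const) auto
  also have "altsum (\<lambda>x. x [^] ?n \<otimes> (?e \<otimes> h \<otimes> c)) x L = cube_top L \<otimes> (?e \<otimes> h \<otimes> c)"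
    using h Cons.prems by (intro Cons.IH[OF p]) auto
  finally show ?case
    using h Cons.prems cube_top_closed[OF L] by (simp add: m_ac)
qed

lemma cube_top_nonzero:
  "x \<in> carrier R \<Longrightarrow> proper_cube x L \<Longrightarrow> (\<And>i. i \<in> {1..length L} \<Longrightarrow> [i] \<cdot> \<one> \<noteq> \<zero>) \<Longrightarrow> cube_top L \<noteq> \<zero>"
proof (induction L)
  case (Cons h L)
  have p: "proper_cube x L" and h: "h \<in> carrier R" using Cons.prems by auto
  have "cube_top L \<noteq> \<zero>" using Cons.prems p by (intro Cons.IH) auto
  moreover have "[Suc (length L)] \<cdot> \<one> \<noteq> \<zero>" by (rule Cons.prems) simp
  ultimately show ?case
    using proper_cube_edge_nonzero[OF Cons.prems(1,2)] h cube_top_closed[OF proper_cube_carrier[OF p]]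
      add.nat_pow_closed[OF one_closed] integral
    by (metis cube_top.simps(2) m_closed)
qed simp

text \<open>The value is linear in the edge \<open>h\<close>, with coefficient
  \<open>[Suc k] \<cdot> \<one> \<otimes> cube_top L\<close>, which is nonzero. Excluding one value
  therefore forbids at most one edge.\<close>

lemma inj_on_altsum_pos_pow:
  assumes x: "x \<in> carrier R" and L: "proper_cube x L" "length L = k"
    and char: "\<And>i. i \<in> {1..Suc k} \<Longrightarrow> [i] \<cdot> \<one> \<noteq> \<zero>"
  shows "inj_on (\<lambda>h. altsum (\<lambda>y. pos_pow R y (Suc k)) x (h # L)) {h. proper_cube x (h # L)}"
proof (rule inj_onI, clarify)
  fix h h'
  assume p: "proper_cube x (h # L)" "proper_cube x (h' # L)"
    and eq: "altsum (\<lambda>y. pos_pow R y (Suc k)) x (h # L) = altsum (\<lambda>y. pos_pow R y (Suc k)) x (h' # L)"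
  note LC = proper_cube_carrier[OF L(1)]
  have *: "altsum (\<lambda>y. pos_pow R y (Suc k)) x (h # L) = cube_top (h # L)"
    if p: "proper_cube x (h # L)" for h
  proof -
    have "altsum (\<lambda>y. pos_pow R y (Suc k)) x (h # L) = altsum (\<lambda>y. y [^] length (h # L) \<otimes> \<one>) x (h # L)"
      using L(2) pos_pow_eq_pow[of _ "Suc k"] by (intro altsum_cong[OF x proper_cube_carrier[OF p]]) auto
    also have "\<dots> = cube_top (h # L) \<otimes> \<one>" by (rule altsum_pow[OF x p one_closed])
    finally show ?thesis using cube_top_closed[OF proper_cube_carrier[OF p]] by simp
  qed
  have h: "h \<in> carrier R" "h' \<in> carrier R" using p by auto
  let ?e = "[Suc k] \<cdot> \<one>"
  have e: "?e \<noteq> \<zero>" "?e \<in> carrier R" by (rule char) auto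
  have t: "cube_top L \<noteq> \<zero>" using L(2) char by (intro cube_top_nonzero[OF x L(1)]) auto
  have tc: "cube_top L \<in> carrier R" by (rule cube_top_closed[OF LC])
  have et: "?e \<otimes> cube_top L \<noteq> \<zero>" using e t tc integral by blast
  have "(?e \<otimes> cube_top L) \<otimes> h = (?e \<otimes> cube_top L) \<otimes> h'"
    using eq h e tc unfolding *[OF p(1)] *[OF p(2)] by (simp add: L(2) m_ac)
  then show "h = h'" using m_lcancel[OF et] e tc h by simp
qed

end

section \<open>Families of sets with equal power sums\<close>

context abelian_group
begin

lemma a_minus_eq_a_minusI:
  assumes "a \<oplus> t = b \<oplus> n" "a \<in> carrier G" "b \<in> carrier G" "t \<in> carrier G" "n \<in> carrier G"
  shows "t \<ominus> n = b \<ominus> a"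
proof -
  have "t = \<ominus> a \<oplus> (b \<oplus> n)" using assms by (metis r_neg1)
  also have "\<dots> = (b \<ominus> a) \<oplus> n" using assms by (simp add: minus_eq a_ac)
  finally show ?thesis using assms by (simp add: a_minus_eq_iff)
qed

text \<open>With \<open>e = 2 ^ d - d - 1\<close>, the set \<open>A\<close> of
  \<open>balog_szemeredi_gowers\<close> contains at least
  \<open>\<kappa> ^ (2 ^ d + 3 * e) * n ^ (d + 1) / C0\<close> cubes, where
  \<open>n = card S\<close>. The energy hypothesis makes \<open>\<kappa> ^ q * n\<close> exceed
  \<open>C0 * K\<close>, and \<open>2 ^ d + 3 * e \<le> q\<close>.\<close>

lemma card_cubes_gt:
  fixes c K :: real
  assumes S: "finite S" "S \<subseteq> carrier G" "S \<noteq> {}" and d: "d \<ge> 1" and K: "K \<ge> 1"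
    and c: "c \<ge> 8 ^ (2 ^ d) * 2048 ^ (2 ^ d - d - 1) * K"
    and E: "real (additive_energy G S) > c * real (card S) powr (3 - 1 / (5 * (2 ^ d - 1)))"
  shows "real (card (cubes d S)) > K * real (card S) ^ d"
proof -
  let ?n = "real (card S)"
  define q :: nat where "q = 5 * (2 ^ d - 1)"
  define e :: nat where "e = 2 ^ d - d - 1"
  define C0 :: real where "C0 = 8 ^ (2 ^ d) * 2048 ^ e"
  define \<kappa> where "\<kappa> = real (additive_energy G S) / ?n ^ 3"
  have n1: "?n \<ge> 1" using S by (simp add: Suc_le_eq card_gt_0_iff)
  have "1 * 1 \<le> C0" unfolding C0_def by (intro mult_mono) auto
  then have C0: "C0 \<ge> 1" by simp
  have c: "c \<ge> C0 * K" using c by (simp add: C0_def e_def)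
  have c1: "c \<ge> 1" using c C0 K by (smt (verit) mult_le_cancel_left1)
  have e: "2 ^ d = d + 1 + e" using Suc_le_two_power[of d] by (simp add: e_def)
  have d2: "(2::nat) \<le> 2 ^ d" using power_increasing[OF d, of "2::nat"] by simp
  have q1: "q \<ge> 1" using d2 by (simp add: q_def)
  have rq: "real q = 5 * (2 ^ d - 1)" using d2 by (simp add: q_def of_nat_diff)
  have pq: "2 ^ d + 3 * e \<le> q" using e d2 by (simp add: q_def)
  have "c * ?n powr (3 - 1 / real q) < real (additive_energy G S)"
    using E by (simp add: rq)
  also have "\<dots> = \<kappa> * ?n ^ 3" using n1 by (simp add: \<kappa>_def)
  also have "?n ^ 3 = ?n powr (3 - 1 / real q) * ?n powr (1 / real q)"
    using n1 by (simp flip: powr_add powr_numeral)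
  finally have "c * ?n powr (3 - 1 / real q) < (\<kappa> * ?n powr (1 / real q)) * ?n powr (3 - 1 / real q)"
    by (simp add: mult_ac)
  then have ck: "c < \<kappa> * ?n powr (1 / real q)"
    by (rule mult_right_less_imp_less) simp
  have k0: "\<kappa> > 0" using ck c1 n1 by (smt (verit) mult_nonneg_nonpos2 mult.commute powr_ge_zero)
  have k1: "\<kappa> \<le> 1"
  proof -
    have "real (additive_energy G S) \<le> real (card S ^ 3)"
      using additive_energy_le_cube[OF S(1,2)] by (rule of_nat_mono)
    then show ?thesis using n1 by (simp add: \<kappa>_def pos_divide_le_eq)
  qed
  \<comment> \<open>The power \<open>q\<close> turns \<open>?n powr (1 / real q)\<close> into
    \<open>?n\<close>; afterwards \<open>\<kappa> \<le> 1\<close> allows the exponent of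
    \<open>\<kappa>\<close> to be lowered.\<close>
  have "c \<le> c ^ q" using c1 q1 by (simp add: self_le_power)
  also have "c ^ q < (\<kappa> * ?n powr (1 / real q)) ^ q"
    using ck c1 q1 by (intro power_strict_mono) auto
  also have "\<dots> = \<kappa> ^ q * ?n"
    using n1 q1 by (simp add: power_mult_distrib powr_power)
  also have "\<dots> \<le> \<kappa> ^ (2 ^ d + 3 * e) * ?n"
    using k0 k1 pq n1 by (intro mult_right_mono power_decreasing) auto
  finally have main: "C0 * K < \<kappa> ^ (2 ^ d + 3 * e) * ?n" using c by linarith
  have "real (additive_energy G S) = \<kappa> * ?n ^ 3" using n1 by (simp add: \<kappa>_def)
  then obtain A where A: "A \<subseteq> S" "real (card A) \<ge> \<kappa> * ?n / 8"
    "real (card (diff_set A)) \<le> 2048 * ?n / \<kappa> ^ 3"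
    using balog_szemeredi_gowers[OF S(1,2) k0 S(3)] by blast
  have finA: "finite A" "A \<subseteq> carrier G" using A S finite_subset by auto
  let ?N = "real (card (cubes d S))"
  have "(\<kappa> * ?n / 8) ^ (2 ^ d) \<le> real (card A) ^ (2 ^ d)"
    using A k0 by (intro power_mono) auto
  also have "\<dots> \<le> real (card (cubes d A)) * real (card (diff_set A)) ^ e"
    unfolding e_def
    by (rule card_cubes_ge[OF finite_diff_set[OF finA(1)] diff_set_carrier[OF finA(2)] finA order_refl])
  also have "\<dots> \<le> ?N * (2048 * ?n / \<kappa> ^ 3) ^ e"
    using A card_cubes_mono[OF S(1,2) A(1)] by (intro mult_mono power_mono) auto
  finally have "(\<kappa> * ?n / 8) ^ (2 ^ d) * (8 ^ (2 ^ d) * \<kappa> ^ (3 * e))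
      \<le> ?N * (2048 * ?n / \<kappa> ^ 3) ^ e * (8 ^ (2 ^ d) * \<kappa> ^ (3 * e))"
    using k0 by (intro mult_right_mono) auto
  also have "?N * (2048 * ?n / \<kappa> ^ 3) ^ e * (8 ^ (2 ^ d) * \<kappa> ^ (3 * e)) = ?N * C0 * ?n ^ e"
    using k0 by (simp add: C0_def power_divide power_mult_distrib power_mult)
  also have "(\<kappa> * ?n / 8) ^ (2 ^ d) * (8 ^ (2 ^ d) * \<kappa> ^ (3 * e))
      = \<kappa> ^ (2 ^ d + 3 * e) * ?n * ?n ^ d * ?n ^ e"
  proof -
    \<comment> \<open>The factor \<open>?n ^ e\<close> will cancel against the one from the
      difference set, leaving \<open>?n ^ (d + 1)\<close>.\<close>
    have "?n ^ (2 ^ d) = ?n * ?n ^ d * ?n ^ e" by (simp add: e power_add)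
    then show ?thesis by (simp add: power_divide power_mult_distrib power_add)
  qed
  finally have "\<kappa> ^ (2 ^ d + 3 * e) * ?n * ?n ^ d \<le> ?N * C0"
    using n1 by (simp add: mult_le_cancel_right)
  moreover have "C0 * K * ?n ^ d < \<kappa> ^ (2 ^ d + 3 * e) * ?n * ?n ^ d"
    using main n1 by (intro mult_strict_right_mono) auto
  ultimately have "(K * ?n ^ d) * C0 < ?N * C0" by (simp add: mult_ac)
  then show ?thesis using C0 by (simp add: mult_less_cancel_right)
qed

lemma ex_good_cube:
  assumes S: "finite S" "S \<subseteq> carrier G" and U: "finite U" "card U \<le> M"
    and X: "\<And>x L. (x, L) \<in> cubes (length L) S \<Longrightarrow> good_cube U X x L \<Longrightarrow> length L < d \<Longrightarrow>
      finite (X x L) \<and> card (X x L) \<le> M"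
    and many: "(d + 1) * M * card S ^ d < card (cubes d S)"
  obtains x L where "(x, L) \<in> cubes d S" "good_cube U X x L"
proof -
  have "card {(x, L) \<in> cubes d S. \<not> good_cube U X x L} \<le> (d + 1) * M * card S ^ d"
    by (rule card_not_good_cubes_le[OF S U X])
  then have "{(x, L) \<in> cubes d S. \<not> good_cube U X x L} \<noteq> cubes d S"
    using many by auto
  then show thesis using that by auto
qed

text \<open>If \<open>v \<oplus> h\<close> is an old vertex or a point of \<open>U\<close>, then
  \<open>h\<close> is the difference of that point and \<open>v\<close>; so forbidding these
  differences suffices.\<close>

lemma good_cube_imp_proper:
  assumes U: "U \<subseteq> carrier G" and x: "x \<in> carrier G"
    and X: "\<And>L. diff_set (verts x L) \<subseteq> X x L" "\<And>L. (\<lambda>(u, v). u \<ominus> v) ` (U \<times> verts x L) \<subseteq> X x L"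
  shows "set L \<subseteq> carrier G \<Longrightarrow> good_cube U X x L \<Longrightarrow> proper_cube x L \<and> verts x L \<inter> U = {}"
proof (induction L)
  case (Cons h L)
  have h: "h \<in> carrier G" and IH: "proper_cube x L" "verts x L \<inter> U = {}" using Cons by auto
  have V: "verts x L \<subseteq> carrier G" using x Cons.prems by (intro verts_carrier) auto
  have hX: "h \<notin> X x L" using Cons.prems by simp
  have *: "(v \<oplus> h) \<ominus> v = h" if "v \<in> verts x L" for v
  proof -
    have v: "v \<in> carrier G" using that V by auto
    then show ?thesis using h by (simp add: a_minus_eq_iff a_comm)
  qed
  have "(\<lambda>v. v \<oplus> h) ` verts x L \<inter> verts x L = {}"
  proof (rule ccontr)
    assume "(\<lambda>v. v \<oplus> h) ` verts x L \<inter> verts x L \<noteq> {}"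
    then obtain v where v: "v \<in> verts x L" "v \<oplus> h \<in> verts x L" by auto
    then have "(v \<oplus> h) \<ominus> v \<in> diff_set (verts x L)" by (intro diff_set_memI)
    then show False using *[OF v(1)] X(1)[of L] hX by auto
  qed
  moreover have "(\<lambda>v. v \<oplus> h) ` verts x L \<inter> U = {}"
  proof (rule ccontr)
    assume "(\<lambda>v. v \<oplus> h) ` verts x L \<inter> U \<noteq> {}"
    then obtain v where v: "v \<in> verts x L" "v \<oplus> h \<in> U" by auto
    then have "h \<in> (\<lambda>(u, v). u \<ominus> v) ` (U \<times> verts x L)"
      using *[OF v(1)] by (intro image_eqI[of _ _ "(v \<oplus> h, v)"]) auto
    then show False using X(2)[of L] hX by auto
  qed
  ultimately show ?case using h IH by (auto simp: Int_Un_distrib2)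
qed simp

end

section \<open>Building the family from disjoint cubes\<close>

context nonunital_ring
begin

lemma power_sum_closed: "A \<subseteq> carrier R \<Longrightarrow> j \<ge> 1 \<Longrightarrow> power_sum R j A \<in> carrier R"
  unfolding power_sum_def using pos_pow_closed by (intro finsum_closed) auto

lemma power_sum_Un_disjoint:
  "finite A \<Longrightarrow> finite B \<Longrightarrow> A \<inter> B = {} \<Longrightarrow> A \<subseteq> carrier R \<Longrightarrow> B \<subseteq> carrier R \<Longrightarrow> j \<ge> 1 \<Longrightarrow>
    power_sum R j (A \<union> B) = power_sum R j A \<oplus> power_sum R j B"
  unfolding power_sum_def using pos_pow_closed by (intro finsum_Un_disjoint) auto

text \<open>\<open>U\<close> is the union of \<open>l\<close> disjoint cubes, and a member of
  \<open>F\<close> takes one half of each. The summands of the bound on \<open>M\<close> count the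
  edges that lead into \<open>U\<close>, make the cube degenerate, or repeat a difference of top
  power sums. \<open>P\<close> switches on the last condition, so one construction serves both
  claims.\<close>

lemma equal_power_sums_family:
  assumes S: "finite S" "S \<subseteq> carrier R"
    and many: "(k + 2) * M * card S ^ (k + 1) < card (cubes (k + 1) S)"
    and inj: "\<forall>x L. P \<longrightarrow> x \<in> carrier R \<longrightarrow> proper_cube x L \<longrightarrow> length L = k \<longrightarrow>
      inj_on (\<lambda>h. altsum (\<lambda>y. pos_pow R y (Suc k)) x (h # L)) {h. proper_cube x (h # L)}"
  shows "l * 2 ^ (k + 1) * 2 ^ k + 4 ^ k + 4 ^ l \<le> M \<Longrightarrow>
    \<exists>U F. U \<subseteq> S \<and> card U \<le> l * 2 ^ (k + 1) \<and> card F = 2 ^ l \<and>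
      (\<forall>A\<in>F. A \<subseteq> U \<and> card A = l * 2 ^ k) \<and>
      (\<forall>j\<in>{1..k}. \<forall>A\<in>F. \<forall>B\<in>F. power_sum R j A = power_sum R j B) \<and>
      (P \<longrightarrow> inj_on (power_sum R (k + 1)) F)"
proof (induction l)
  case 0
  show ?case by (rule exI[of _ "{}"], rule exI[of _ "{{}}"]) simp
next
  case (Suc l)
  have "l * 2 ^ (k + 1) * 2 ^ k + 4 ^ k + 4 ^ l \<le> Suc l * 2 ^ (k + 1) * 2 ^ k + 4 ^ k + (4::nat) ^ Suc l"
    by (intro add_mono mult_mono power_increasing) auto
  with Suc.prems have M: "l * 2 ^ (k + 1) * 2 ^ k + 4 ^ k + 4 ^ l \<le> M" by linarith
  from Suc.IH[OF M] obtain U F where U: "U \<subseteq> S" "card U \<le> l * 2 ^ (k + 1)" and cF: "card F = 2 ^ l"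
    and F: "\<forall>A\<in>F. A \<subseteq> U \<and> card A = l * 2 ^ k"
    and eqF: "\<forall>j\<in>{1..k}. \<forall>A\<in>F. \<forall>B\<in>F. power_sum R j A = power_sum R j B"
    and injF: "P \<longrightarrow> inj_on (power_sum R (k + 1)) F"
    by (elim exE conjE) (rule that)
  note F = bspec[OF F, THEN conjunct1] bspec[OF F, THEN conjunct2]
  note eqF = eqF[rule_format] and injF = injF[rule_format]
  let ?ps = "power_sum R (k + 1)"
  have finU: "finite U" and UC: "U \<subseteq> carrier R" using U S finite_subset by auto
  have finF: "finite F" using cF by (metis card.infinite power_not_zero zero_neq_numeral)
  define W where "W = (\<lambda>(A, B). ?ps A \<ominus> ?ps B) ` (F \<times> F)"
  have finW: "finite W" using finF by (simp add: W_def)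
  have "card W \<le> card (F \<times> F)" unfolding W_def using finF by (intro card_image_le) auto
  also have "\<dots> = 4 ^ l" by (simp add: card_cartesian_product cF flip: power_mult_distrib)
  finally have cW: "card W \<le> 4 ^ l" .
  let ?alt = "\<lambda>x L. altsum (\<lambda>y. pos_pow R y (Suc k)) x L"
  \<comment> \<open>The third kind of forbidden edge concerns only the last edge added, at
    \<open>length L = k\<close>, when the cube is complete.\<close>
  define X where "X = (\<lambda>x L. diff_set (verts x L) \<union> (\<lambda>(u, v). u \<ominus> v) ` (U \<times> verts x L) \<union>
    (if P \<and> length L = k then {h. proper_cube x (h # L) \<and> ?alt x (h # L) \<in> W} else {}))"
  have X12: "diff_set (verts x L) \<subseteq> X x L" "(\<lambda>(u, v). u \<ominus> v) ` (U \<times> verts x L) \<subseteq> X x L" for x L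
    by (auto simp: X_def)
  have cX: "finite (X x L) \<and> card (X x L) \<le> M" if xL: "(x, L) \<in> cubes (length L) S" "length L < k + 1" for x L
  proof -
    have x: "x \<in> carrier R" using xL S base_in_verts[of x L] by (auto simp: cubes_def)
    have "card (verts x L) \<le> 2 ^ length L" by (rule card_verts_le)
    also have "\<dots> \<le> 2 ^ k" using xL by (intro power_increasing) auto
    finally have cV: "card (verts x L) \<le> 2 ^ k" .
    let ?Y1 = "diff_set (verts x L)" and ?Y2 = "(\<lambda>(u, v). u \<ominus> v) ` (U \<times> verts x L)"
    let ?Y3 = "if P \<and> length L = k then {h. proper_cube x (h # L) \<and> ?alt x (h # L) \<in> W} else {}"
    have f12: "finite ?Y1" "finite ?Y2" using finite_verts finU finite_diff_set by auto
    have "card ?Y1 \<le> 2 ^ k * 2 ^ k"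
      using card_diff_set_le[OF finite_verts, of x L] mult_mono[OF cV cV] by simp
    also have "\<dots> = 4 ^ k" by (simp flip: power_mult_distrib)
    finally have Y1: "card ?Y1 \<le> 4 ^ k" .
    have "card ?Y2 \<le> card (U \<times> verts x L)" using finU finite_verts by (intro card_image_le) auto
    also have "\<dots> \<le> l * 2 ^ (k + 1) * 2 ^ k"
      unfolding card_cartesian_product by (rule mult_mono[OF U(2) cV]) auto
    finally have Y2: "card ?Y2 \<le> l * 2 ^ (k + 1) * 2 ^ k" .
    have Y3: "finite ?Y3 \<and> card ?Y3 \<le> 4 ^ l"
    \<comment> \<open>A face that is not proper has no proper extension, so the third set is then
      empty.\<close>
    proof (cases "P \<and> length L = k \<and> proper_cube x L")
      case True
      let ?Z = "{h. proper_cube x (h # L) \<and> ?alt x (h # L) \<in> W}"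
      have i: "inj_on (\<lambda>h. ?alt x (h # L)) ?Z"
        using True by (intro inj_on_subset[OF inj[rule_format, OF _ x]]) auto
      have s: "(\<lambda>h. ?alt x (h # L)) ` ?Z \<subseteq> W" by auto
      have "finite ?Z" by (rule inj_on_finite[OF i s finW])
      moreover have "card ?Z \<le> card W" by (rule card_inj_on_le[OF i s finW])
      ultimately show ?thesis using cW True by simp
    next
      case False
      then have "?Y3 = {}" by auto
      then show ?thesis by (simp only: finite.emptyI card.empty) simp
    qed
    have "card (X x L) \<le> card (?Y1 \<union> ?Y2) + card ?Y3" unfolding X_def by (rule card_Un_le)
    also have "card (?Y1 \<union> ?Y2) \<le> card ?Y1 + card ?Y2" by (rule card_Un_le)
    finally have "card (X x L) \<le> M" using Y1 Y2 Y3 M by linarith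
    moreover have "finite (X x L)" unfolding X_def using f12 Y3 by (intro finite_UnI) auto
    ultimately show ?thesis by simp
  qed
  have "l * 2 ^ (k + 1) * 1 \<le> l * 2 ^ (k + 1) * (2::nat) ^ k" by (intro mult_left_mono) auto
  then have UM: "card U \<le> M" using U M by linarith
  obtain x L where xL: "(x, L) \<in> cubes (k + 1) S" and good: "good_cube U X x L"
    using ex_good_cube[OF S finU UM, of X "k + 1"] cX many by auto
  have VS: "verts x L \<subseteq> S" and LC: "set L \<subseteq> carrier R" and len: "length L = Suc k"
    using xL by (auto simp: cubes_def)
  have x: "x \<in> carrier R" using VS S base_in_verts[of x L] by auto
  have p: "proper_cube x L" and VU: "verts x L \<inter> U = {}"
    using good_cube_imp_proper[OF UC x X12 LC good] by auto
  define T where "T = half True x L"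
  define N where "N = half False x L"
  have TN: "T \<inter> N = {}" using half_disjoint[OF x p, of True] by (simp add: T_def N_def)
  have cTN: "card T = 2 ^ k" "card N = 2 ^ k"
    using card_half[OF x p len] by (simp_all add: T_def N_def)
  have sub: "T \<subseteq> verts x L" "N \<subseteq> verts x L" by (simp_all add: T_def N_def half_subset_verts)
  have fin: "finite T" "finite N" by (simp_all add: T_def N_def finite_half)
  have disj: "U \<inter> T = {}" "U \<inter> N = {}" using VU sub by auto
  have TNC: "T \<subseteq> carrier R" "N \<subseteq> carrier R" using sub VS S by auto
  have AC: "A \<subseteq> carrier R" "finite A" if "A \<in> F" for A
    using F(1)[OF that] UC finU finite_subset by auto
  have psU: "power_sum R j (A \<union> Y) = power_sum R j A \<oplus> power_sum R j Y"
    if "A \<in> F" "Y \<in> {T, N}" "j \<ge> 1" for j A Y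
  proof (rule power_sum_Un_disjoint)
    show "A \<inter> Y = {}" using F(1)[OF that(1)] disj that(2) by auto
  qed (use that AC fin TNC in auto)
  have psTN: "power_sum R j T = power_sum R j N" if "j \<in> {1..k}" for j
    unfolding T_def N_def using that len by (intro power_sum_half_eq[OF x p]) auto
  define F' where "F' = (\<lambda>(A, Y). A \<union> Y) ` (F \<times> {T, N})"
  have "T \<noteq> {}" "N \<noteq> {}" using cTN by auto
  then have injAY: "inj_on (\<lambda>(A, Y). A \<union> Y) (F \<times> {T, N})"
  proof (intro inj_onI, clarify)
    fix A Y A' Y' assume m: "A \<in> F" "A' \<in> F" "Y \<in> {T, N}" "Y' \<in> {T, N}" and eq: "A \<union> Y = A' \<union> Y'"
    \<comment> \<open>The new cube is disjoint from \<open>U\<close>, so \<open>U\<close> separates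
      the old part from the new half.\<close>
    have "A = (A \<union> Y) \<inter> U" "A' = (A' \<union> Y') \<inter> U" "Y = (A \<union> Y) - U" "Y' = (A' \<union> Y') - U"
      using F(1) m disj by blast+
    then show "A = A' \<and> Y = Y'" using eq by simp
  qed
  have TneqN: "T \<noteq> N" using \<open>T \<noteq> {}\<close> TN by auto
  have "card F' = 2 ^ Suc l"
    unfolding F'_def card_image[OF injAY] card_cartesian_product using TneqN by (simp add: cF)
  moreover have "U \<union> verts x L \<subseteq> S" using U VS by auto
  moreover have "card (U \<union> verts x L) \<le> Suc l * 2 ^ (k + 1)"
    using card_Un_le[of U "verts x L"] U(2) card_verts_le[of x L] by (simp add: len)
  moreover have "\<forall>A\<in>F'. A \<subseteq> U \<union> verts x L \<and> card A = Suc l * 2 ^ k"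
  proof
    fix B assume "B \<in> F'"
    then obtain A Y where B: "B = A \<union> Y" "A \<in> F" "Y \<in> {T, N}" by (auto simp: F'_def)
    then have "A \<subseteq> U" "A \<inter> Y = {}" "finite Y" "card Y = 2 ^ k" "Y \<subseteq> verts x L"
      using F(1) disj fin cTN sub by blast+
    then show "B \<subseteq> U \<union> verts x L \<and> card B = Suc l * 2 ^ k"
      using AC(2)[OF B(2)] F(2)[OF B(2)] unfolding B(1) by (simp add: card_Un_disjoint) blast
  qed
  moreover have "\<forall>j\<in>{1..k}. \<forall>A\<in>F'. \<forall>B\<in>F'. power_sum R j A = power_sum R j B"
  proof (intro ballI)
    fix j B B' assume j: "j \<in> {1..k}" and "B \<in> F'" "B' \<in> F'"
    then obtain A Y A' Y' where B: "B = A \<union> Y" "A \<in> F" "Y \<in> {T, N}"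
      and B': "B' = A' \<union> Y'" "A' \<in> F" "Y' \<in> {T, N}" by (auto simp: F'_def)
    have "power_sum R j Y = power_sum R j Y'" using psTN[OF j] B(3) B'(3) by auto
    then show "power_sum R j B = power_sum R j B'"
      using psU[OF B(2,3)] psU[OF B'(2,3)] eqF[OF j B(2) B'(2)] j by (simp add: B(1) B'(1))
  qed
  moreover have "inj_on ?ps F'" if P: P
  proof (rule inj_onI)
    fix B B' assume "B \<in> F'" "B' \<in> F'" and eq: "?ps B = ?ps B'"
    then obtain A Y A' Y' where B: "B = A \<union> Y" "A \<in> F" "Y \<in> {T, N}"
      and B': "B' = A' \<union> Y'" "A' \<in> F" "Y' \<in> {T, N}" by (auto simp: F'_def)
    have cl: "?ps A \<in> carrier R" "?ps A' \<in> carrier R" "?ps T \<in> carrier R" "?ps N \<in> carrier R"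
      using AC B(2) B'(2) TNC by (auto intro!: power_sum_closed)
    have eq': "?ps A \<oplus> ?ps Y = ?ps A' \<oplus> ?ps Y'"
      using eq psU[OF B(2,3), of "k + 1"] psU[OF B'(2,3), of "k + 1"] by (simp add: B(1) B'(1))
    obtain h L' where L': "L = h # L'" "length L' = k" using len by (auto simp: length_Suc_conv)
    have notW: "?ps T \<ominus> ?ps N \<noteq> ?ps A1 \<ominus> ?ps A2" if "A1 \<in> F" "A2 \<in> F" for A1 A2
    proof
      assume "?ps T \<ominus> ?ps N = ?ps A1 \<ominus> ?ps A2"
      moreover have "?ps T \<ominus> ?ps N = ?alt x L" by (simp add: power_sum_def altsum_def T_def N_def)
      moreover have "?ps A1 \<ominus> ?ps A2 \<in> W"
        unfolding W_def by (rule image_eqI[of _ _ "(A1, A2)"]) (use that in auto)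
      ultimately have "?alt x (h # L') \<in> W" using L'(1) by metis
      then have "h \<in> X x L'" using P p L' by (simp add: X_def)
      then show False using good L' by simp
    qed
    show "B = B'"
    proof (cases "Y = Y'")
      case True
      have "?ps Y \<in> carrier R" using B(3) cl by auto
      then have "?ps A = ?ps A'" using eq' cl True a_right_cancelD by metis
      then have "A = A'" using injF[OF P] B(2) B'(2) by (auto dest: inj_onD)
      then show ?thesis using B B' True by simp
    next
      case False
      \<comment> \<open>If the new halves differ, equal top power sums would put the difference for
        \<open>T\<close> and \<open>N\<close> into \<open>W\<close>.\<close>
      then consider "Y = T" "Y' = N" | "Y = N" "Y' = T" using B(3) B'(3) by auto
      then show ?thesis
      proof cases
        case 1
        then show ?thesis using a_minus_eq_a_minusI[of "?ps A" "?ps T" "?ps A'" "?ps N"] eq' cl notW[OF B'(2) B(2)] by simp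
      next
        case 2
        then show ?thesis using a_minus_eq_a_minusI[of "?ps A'" "?ps T" "?ps A" "?ps N"] eq' cl notW[OF B(2) B'(2)] by simp
      qed
    qed
  qed
  ultimately show ?case by blast
qed

end

text \<open>
  The bases \<open>8\<close> and \<open>2048\<close> stem from \<open>balog_szemeredi_gowers\<close>; the factor next to \<open>k + 2\<close> bounds
  the number of edges that the construction of \<open>equal_power_sums_family\<close> has to avoid.
\<close>

definition energy_threshold :: "nat \<Rightarrow> nat \<Rightarrow> real" where
  "energy_threshold k l = 8 ^ (2 ^ (k + 1)) * 2048 ^ (2 ^ (k + 1) - (k + 1) - 1) *
     real ((k + 2) * (l * 2 ^ (k + 1) * 2 ^ k + 4 ^ k + 4 ^ l))"

lemma energy_threshold_pos: "energy_threshold k l > 0"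
  unfolding energy_threshold_def by (intro mult_pos_pos) (simp_all del: of_nat_mult of_nat_add)

lemma add_pow_one_nonzero:
  assumes "domain R" "ring_characteristic R = 0 \<or> ring_characteristic R > n" "i \<in> {1..n}"
  shows "[i] \<cdot>\<^bsub>R\<^esub> \<one>\<^bsub>R\<^esub> \<noteq> \<zero>\<^bsub>R\<^esub>"
proof
  assume i: "[i] \<cdot>\<^bsub>R\<^esub> \<one>\<^bsub>R\<^esub> = \<zero>\<^bsub>R\<^esub>"
  let ?P = "\<lambda>n::nat. n > 0 \<and> [n] \<cdot>\<^bsub>R\<^esub> \<one>\<^bsub>R\<^esub> = \<zero>\<^bsub>R\<^esub>"
  have Pi: "?P i" using i assms(3) by simp
  then have "ring_characteristic R = (LEAST n. ?P n)"
    unfolding ring_characteristic_def by (intro if_P) blast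
  moreover have "(LEAST n. ?P n) \<le> i" using Pi by (rule Least_le)
  moreover have "?P (LEAST n. ?P n)" using Pi by (rule LeastI)
  ultimately show False using assms by auto
qed

lemma two_power_ceiling_log_ge:
  assumes "m \<ge> 1"
  shows "m \<le> 2 ^ nat \<lceil>log 2 (real m)\<rceil>"
proof -
  have "real m = 2 powr log 2 (real m)" using assms by simp
  also have "\<dots> \<le> 2 powr real (nat \<lceil>log 2 (real m)\<rceil>)"
    by (intro powr_mono real_nat_ceiling_ge) auto
  also have "\<dots> = real (2 ^ nat \<lceil>log 2 (real m)\<rceil>)" by (simp add: powr_realpow)
  finally show ?thesis by linarith
qed

theorem energy_constant_threshold:
  assumes "m \<ge> 1"
  shows "energy_constant TYPE('a) k m (energy_threshold k (nat \<lceil>log 2 (real m)\<rceil>))"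
  unfolding energy_constant_def
proof (intro allI impI)
  fix R :: "'a ring" and S
  let ?l = "nat \<lceil>log 2 (real m)\<rceil>"
  let ?M = "?l * 2 ^ (k + 1) * 2 ^ k + 4 ^ k + 4 ^ ?l"
  let ?P = "domain R \<and> (ring_characteristic R = 0 \<or> ring_characteristic R > k + 1)"
  assume R: "nonunital_ring R" and S: "S \<subseteq> carrier R" "finite S" "S \<noteq> {}"
    and E: "energy_threshold k ?l * real (card S) powr (3 - 1 / (5 * (2 ^ (k + 1) - 1)))
      < real (additive_energy R S)"
  interpret nonunital_ring R by (rule R)
  have "real ((k + 2) * ?M) * real (card S) ^ (k + 1) < real (card (cubes (k + 1) S))"
  proof (rule card_cubes_gt[OF S(2,1,3) _ _ _ E])
    have "1 \<le> (k + 2) * ?M" by (simp add: Suc_le_eq)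
    then show "1 \<le> real ((k + 2) * ?M)" by (metis of_nat_1 of_nat_mono)
    show "8 ^ (2 ^ (k + 1)) * 2048 ^ (2 ^ (k + 1) - (k + 1) - 1) * real ((k + 2) * ?M)
        \<le> energy_threshold k ?l"
      unfolding energy_threshold_def by (rule order_refl)
  qed simp
  then have many: "(k + 2) * ?M * card S ^ (k + 1) < card (cubes (k + 1) S)"
    by (metis of_nat_less_iff of_nat_mult of_nat_power)
  have inj: "\<forall>x L. ?P \<longrightarrow> x \<in> carrier R \<longrightarrow> proper_cube x L \<longrightarrow> length L = k \<longrightarrow>
    inj_on (\<lambda>h. altsum (\<lambda>y. pos_pow R y (Suc k)) x (h # L)) {h. proper_cube x (h # L)}"
  proof (intro allI impI)
    fix x L assume *: "?P" "x \<in> carrier R" "proper_cube x L" "length L = k"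
    interpret "domain" R using * by simp
    show "inj_on (\<lambda>h. altsum (\<lambda>y. pos_pow R y (Suc k)) x (h # L)) {h. proper_cube x (h # L)}"
      using * add_pow_one_nonzero[of R "k + 1"] by (intro inj_on_altsum_pos_pow) auto
  qed
  from equal_power_sums_family[OF S(2,1) many inj order_refl] obtain U F
    where U: "U \<subseteq> S" and cF: "card F = 2 ^ ?l"
    and F: "\<forall>A\<in>F. A \<subseteq> U \<and> card A = ?l * 2 ^ k"
    and eqF: "\<forall>j\<in>{1..k}. \<forall>A\<in>F. \<forall>B\<in>F. power_sum R j A = power_sum R j B"
    and injF: "?P \<longrightarrow> inj_on (power_sum R (k + 1)) F"
    by (elim exE conjE) (rule that)
  have finF: "finite F" using cF by (metis card.infinite power_not_zero zero_neq_numeral)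
  \<comment> \<open>Any \<open>m\<close> of the at least \<open>m\<close> members of
    \<open>F\<close> serve for both claims.\<close>
  obtain A where A: "bij_betw A {1..card F} F" using ex_bij_betw_nat_finite_1[OF finF] by blast
  have "{1..m} \<subseteq> {1..card F}" using two_power_ceiling_log_ge[OF assms] by (simp add: cF)
  then have injA: "inj_on A {1..m}" and AF: "\<And>i. i \<in> {1..m} \<Longrightarrow> A i \<in> F"
    using A by (auto simp: bij_betw_def intro: inj_on_subset)
  have eps: "equal_power_sums R S k m A"
    unfolding equal_power_sums_def
  proof (intro conjI ballI)
    fix i assume "i \<in> {1..m}"
    then show "A i \<subseteq> S" "card (A i) = ?l * 2 ^ k" using AF F U by blast+
  next
    fix j i assume "j \<in> {1..k}" "i \<in> {1..m}"
    moreover from this have "1 \<in> {1..m}" by auto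
    ultimately show "power_sum R j (A i) = power_sum R j (A 1)" using eqF AF by blast
  qed
  show "(\<exists>A. inj_on A {1..m} \<and> equal_power_sums R S k m A) \<and>
        (?P \<longrightarrow> (\<exists>A. equal_power_sums R S k m A \<and>
               (\<forall>h\<in>{1..m}. \<forall>t\<in>{1..m}. h \<noteq> t \<longrightarrow>
                  power_sum R (k + 1) (A h) \<noteq> power_sum R (k + 1) (A t))))"
  proof (intro conjI impI exI ballI)
    fix h t assume P: ?P and "h \<in> {1..m}" "t \<in> {1..m}" "h \<noteq> t"
    then show "power_sum R (k + 1) (A h) \<noteq> power_sum R (k + 1) (A t)"
      using mp[OF injF P] injA AF by (metis inj_on_eq_iff)
  qed (use injA eps in auto)
qed

section \<open>Independence of the type of the elements\<close>

text \<open>There are countably many terms, so their values form a countable subring. An identity,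
  where wanted, is supplied as a generator.\<close>

datatype ring_term = Gen nat | Zero | Neg ring_term | Add ring_term ring_term | Mult ring_term ring_term

instance ring_term :: countable
  by countable_datatype

primrec eval_term :: "('a, 'b) ring_scheme \<Rightarrow> (nat \<Rightarrow> 'a) \<Rightarrow> ring_term \<Rightarrow> 'a" where
  "eval_term R s (Gen n) = s n"
| "eval_term R s Zero = \<zero>\<^bsub>R\<^esub>"
| "eval_term R s (Neg t) = \<ominus>\<^bsub>R\<^esub> eval_term R s t"
| "eval_term R s (Add t u) = eval_term R s t \<oplus>\<^bsub>R\<^esub> eval_term R s u"
| "eval_term R s (Mult t u) = eval_term R s t \<otimes>\<^bsub>R\<^esub> eval_term R s u"

lemma (in nonunital_ring) ex_countable_subring:
  assumes "countable B" "B \<subseteq> carrier R"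
  obtains T where "countable T" "B \<subseteq> T" "T \<subseteq> carrier R" "\<zero> \<in> T"
    "\<And>x. x \<in> T \<Longrightarrow> \<ominus> x \<in> T"
    "\<And>x y. x \<in> T \<Longrightarrow> y \<in> T \<Longrightarrow> x \<oplus> y \<in> T"
    "\<And>x y. x \<in> T \<Longrightarrow> y \<in> T \<Longrightarrow> x \<otimes> y \<in> T"
proof
  \<comment> \<open>Inserting \<open>\<zero>\<close> makes the set nonempty, as an enumeration of
    exactly its elements requires.\<close>
  let ?s = "from_nat_into (insert \<zero> B)"
  let ?T = "range (eval_term R ?s)"
  have s: "range ?s = insert \<zero> B" using assms by (intro range_from_nat_into) auto
  show "countable ?T" by blast
  show "B \<subseteq> ?T"
  proof
    fix b assume "b \<in> B"
    then obtain n where "b = ?s n" using s by blast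
    then show "b \<in> ?T" by (intro image_eqI[of _ _ "Gen n"]) auto
  qed
  have "eval_term R ?s t \<in> carrier R" for t
  proof (induction t)
    case (Gen n)
    have "?s n \<in> insert \<zero> B" using s by blast
    then show ?case using assms by auto
  qed (auto simp: m_closed)
  then show "?T \<subseteq> carrier R" by blast
  show "\<zero> \<in> ?T" by (intro image_eqI[of _ _ Zero]) auto
  show "\<ominus> x \<in> ?T" if x: "x \<in> ?T" for x
  proof -
    obtain t where "x = eval_term R ?s t" using x by blast
    then show ?thesis by (intro image_eqI[of _ _ "Neg t"]) auto
  qed
  fix x y assume "x \<in> ?T" "y \<in> ?T"
  then obtain t u where tu: "x = eval_term R ?s t" "y = eval_term R ?s u" by blast
  show "x \<oplus> y \<in> ?T" using tu by (intro image_eqI[of _ _ "Add t u"]) auto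
  show "x \<otimes> y \<in> ?T" using tu by (intro image_eqI[of _ _ "Mult t u"]) auto
qed

lemma (in nonunital_ring) power_sum_insert:
  assumes "finite A" "a \<notin> A" "insert a A \<subseteq> carrier R" "j \<ge> 1"
  shows "power_sum R j (insert a A) = pos_pow R a j \<oplus> power_sum R j A"
  unfolding power_sum_def using assms pos_pow_closed by (intro finsum_insert) auto

section \<open>Transport of a subring to another type\<close>

locale subring_copy = nonunital_ring R for R :: "'a ring" (structure) +
  fixes T :: "'a set" and f :: "'a \<Rightarrow> 'b"
  assumes T: "T \<subseteq> carrier R" "\<zero> \<in> T"
    and T_neg: "\<And>x. x \<in> T \<Longrightarrow> \<ominus> x \<in> T"
    and T_add: "\<And>x y. x \<in> T \<Longrightarrow> y \<in> T \<Longrightarrow> x \<oplus> y \<in> T"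
    and T_mult: "\<And>x y. x \<in> T \<Longrightarrow> y \<in> T \<Longrightarrow> x \<otimes> y \<in> T"
    and f: "inj_on f T"
begin

text \<open>The field \<open>one\<close> is meaningful only when \<open>\<one>\<close> lies in
  \<open>T\<close>, which \<open>domain_copy\<close> assumes.\<close>

definition copy :: "'b ring" where
  "copy = \<lparr>carrier = f ` T,
     mult = (\<lambda>x y. f (inv_into T f x \<otimes> inv_into T f y)), one = f \<one>,
     zero = f \<zero>, add = (\<lambda>x y. f (inv_into T f x \<oplus> inv_into T f y))\<rparr>"

lemma copy_simps [simp]:
  "carrier copy = f ` T" "\<one>\<^bsub>copy\<^esub> = f \<one>" "\<zero>\<^bsub>copy\<^esub> = f \<zero>"
  "x \<in> T \<Longrightarrow> y \<in> T \<Longrightarrow> f x \<oplus>\<^bsub>copy\<^esub> f y = f (x \<oplus> y)"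
  "x \<in> T \<Longrightarrow> y \<in> T \<Longrightarrow> f x \<otimes>\<^bsub>copy\<^esub> f y = f (x \<otimes> y)"
  using f by (simp_all add: copy_def)

lemma f_eq_iff: "x \<in> T \<Longrightarrow> y \<in> T \<Longrightarrow> f x = f y \<longleftrightarrow> x = y"
  using f by (auto dest: inj_onD)

lemma TC: "x \<in> T \<Longrightarrow> x \<in> carrier R"
  using T by auto

lemma nonunital_ring_copy: "nonunital_ring copy"
proof (intro nonunital_ring.intro nonunital_ring_axioms.intro abelian_groupI)
  fix x y assume "x \<in> carrier copy" "y \<in> carrier copy"
  then obtain a b where [simp]: "x = f a" "y = f b" and ab: "a \<in> T" "b \<in> T" by auto
  show "x \<oplus>\<^bsub>copy\<^esub> y \<in> carrier copy" "x \<otimes>\<^bsub>copy\<^esub> y \<in> carrier copy"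
    using ab by (simp_all add: T_add T_mult)
  show "x \<oplus>\<^bsub>copy\<^esub> y = y \<oplus>\<^bsub>copy\<^esub> x"
    using ab TC[OF ab(1)] TC[OF ab(2)] by (simp add: a_comm)
  fix z assume "z \<in> carrier copy"
  then obtain c where [simp]: "z = f c" and c: "c \<in> T" by auto
  note C = TC[OF ab(1)] TC[OF ab(2)] TC[OF c]
  show "x \<oplus>\<^bsub>copy\<^esub> y \<oplus>\<^bsub>copy\<^esub> z = x \<oplus>\<^bsub>copy\<^esub> (y \<oplus>\<^bsub>copy\<^esub> z)"
    using ab c C by (simp add: T_add a_assoc)
  show "x \<otimes>\<^bsub>copy\<^esub> y \<otimes>\<^bsub>copy\<^esub> z = x \<otimes>\<^bsub>copy\<^esub> (y \<otimes>\<^bsub>copy\<^esub> z)"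
    using ab c C by (simp add: T_mult m_assoc)
  show "(x \<oplus>\<^bsub>copy\<^esub> y) \<otimes>\<^bsub>copy\<^esub> z = x \<otimes>\<^bsub>copy\<^esub> z \<oplus>\<^bsub>copy\<^esub> y \<otimes>\<^bsub>copy\<^esub> z"
    using ab c C by (simp add: T_add T_mult l_distr)
  show "z \<otimes>\<^bsub>copy\<^esub> (x \<oplus>\<^bsub>copy\<^esub> y) = z \<otimes>\<^bsub>copy\<^esub> x \<oplus>\<^bsub>copy\<^esub> z \<otimes>\<^bsub>copy\<^esub> y"
    using ab c C by (simp add: T_add T_mult r_distr)
next
  show "\<zero>\<^bsub>copy\<^esub> \<in> carrier copy" using T by simp
next
  fix x assume "x \<in> carrier copy"
  then obtain a where a: "x = f a" "a \<in> T" by auto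
  then show "\<zero>\<^bsub>copy\<^esub> \<oplus>\<^bsub>copy\<^esub> x = x" using T TC by simp
  show "\<exists>y\<in>carrier copy. y \<oplus>\<^bsub>copy\<^esub> x = \<zero>\<^bsub>copy\<^esub>"
    using a T_neg TC by (intro bexI[of _ "f (\<ominus> a)"]) (auto simp: l_neg)
qed

sublocale cp: nonunital_ring copy
  by (rule nonunital_ring_copy)

lemma pos_pow_copy:
  assumes "a \<in> T" "j \<ge> 1"
  shows "pos_pow R a j \<in> T \<and> pos_pow copy (f a) j = f (pos_pow R a j)"
  using assms(2)
proof (induction j rule: dec_induct)
  case base
  then show ?case using assms(1) by (simp add: pos_pow_def)
next
  case (step j)
  then show ?case using assms(1) by (simp add: pos_pow_Suc T_mult)
qed

lemma power_sum_copy: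
  assumes "finite A" "A \<subseteq> T" "j \<ge> 1"
  shows "power_sum R j A \<in> T \<and> power_sum copy j (f ` A) = f (power_sum R j A)"
  using assms(1,2)
proof (induction A)
  case empty
  then show ?case using T by (simp add: power_sum_def)
next
  case (insert a A)
  have "f a \<notin> f ` A" using insert f_eq_iff by blast
  moreover have "insert (f a) (f ` A) \<subseteq> carrier copy" using insert by auto
  ultimately have "power_sum copy j (f ` insert a A) = pos_pow copy (f a) j \<oplus>\<^bsub>copy\<^esub> power_sum copy j (f ` A)"
    using insert assms(3) cp.power_sum_insert[of "f ` A" "f a" j] by simp
  moreover have "power_sum R j (insert a A) = pos_pow R a j \<oplus> power_sum R j A"
    using insert assms(3) TC by (intro power_sum_insert) auto
  ultimately show ?case
    using insert pos_pow_copy[of a j] assms(3) by (simp add: T_add)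
qed

lemma additive_energy_copy_ge:
  assumes "finite S" "S \<subseteq> T"
  shows "additive_energy R S \<le> additive_energy copy (f ` S)"
  unfolding additive_energy_def
proof (rule card_inj_on_le)
  let ?h = "\<lambda>(a, b, c, d). (f a, f b, f c, f d)"
  let ?Q = "{(a1, a2, b1, b2). a1 \<in> S \<and> a2 \<in> S \<and> b1 \<in> S \<and> b2 \<in> S \<and> a1 \<oplus> a2 = b1 \<oplus> b2}"
  let ?Q' = "{(a1, a2, b1, b2). a1 \<in> f ` S \<and> a2 \<in> f ` S \<and> b1 \<in> f ` S \<and> b2 \<in> f ` S \<and>
    a1 \<oplus>\<^bsub>copy\<^esub> a2 = b1 \<oplus>\<^bsub>copy\<^esub> b2}"
  show "inj_on ?h ?Q"
    using assms(2) by (auto simp: inj_on_def f_eq_iff subset_iff)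
  show "?h ` ?Q \<subseteq> ?Q'"
    using assms(2) by (auto simp: subset_iff)
  show "finite ?Q'"
    by (rule finite_subset[of _ "f ` S \<times> f ` S \<times> f ` S \<times> f ` S"]) (use assms(1) in auto)
qed

text \<open>Multiples of \<open>\<one>\<close> stay in \<open>T\<close>, where \<open>f\<close> is
  injective, so they vanish in both rings for the same \<open>n\<close>.\<close>

lemma domain_copy:
  assumes "domain R" "\<one> \<in> T"
  shows "domain copy" "ring_characteristic copy = ring_characteristic R"
proof -
  interpret r: "domain" R by fact
  have "comm_monoid copy"
    by (rule comm_monoidI) (auto simp: assms T_mult TC r.m_ac)
  then have "cring copy"
    by (intro cringI) (auto intro: cp.abelian_group_axioms simp: T_add T_mult TC l_distr)
  then show "domain copy"
  proof (intro domain.intro domain_axioms.intro)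
    show "\<one>\<^bsub>copy\<^esub> \<noteq> \<zero>\<^bsub>copy\<^esub>" using assms T by (simp add: f_eq_iff)
    fix a b assume ab: "a \<otimes>\<^bsub>copy\<^esub> b = \<zero>\<^bsub>copy\<^esub>" "a \<in> carrier copy" "b \<in> carrier copy"
    then obtain x y where xy: "a = f x" "b = f y" "x \<in> T" "y \<in> T" by auto
    then have "x \<otimes> y = \<zero>" using ab(1) T T_mult by (simp add: f_eq_iff)
    then show "a = \<zero>\<^bsub>copy\<^esub> \<or> b = \<zero>\<^bsub>copy\<^esub>" using xy r.integral TC by auto
  qed
  have "[n] \<cdot> \<one> \<in> T \<and> [n] \<cdot>\<^bsub>copy\<^esub> \<one>\<^bsub>copy\<^esub> = f ([n] \<cdot> \<one>)" for n :: nat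
  proof (induction n)
    case (Suc n)
    then show ?case using assms(2) by (simp add: T_add)
  qed (use T in simp)
  then have "[n] \<cdot>\<^bsub>copy\<^esub> \<one>\<^bsub>copy\<^esub> = \<zero>\<^bsub>copy\<^esub> \<longleftrightarrow> [n] \<cdot> \<one> = \<zero>" for n :: nat
    using T by (metis copy_simps(3) f_eq_iff)
  then show "ring_characteristic copy = ring_characteristic R"
    by (simp only: ring_characteristic_def)
qed

text \<open>Power sums of subsets of \<open>T\<close> stay in \<open>T\<close>, so the injectivity
  of \<open>f\<close> reflects their equality.\<close>

lemma equal_power_sums_pullback:
  assumes S: "finite S" "S \<subseteq> T" and A: "equal_power_sums copy (f ` S) k m A"
  defines "B \<equiv> \<lambda>i. inv_into T f ` A i"
  shows "equal_power_sums R S k m B"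
    and "\<And>i. i \<in> {1..m} \<Longrightarrow> f ` B i = A i"
    and "\<And>i. i \<in> {1..m} \<Longrightarrow> finite (B i) \<and> B i \<subseteq> T"
proof -
  have AS: "A i \<subseteq> f ` S" if "i \<in> {1..m}" for i
    using A that by (auto simp: equal_power_sums_def)
  have BS: "B i \<subseteq> S" if "i \<in> {1..m}" for i
  proof -
    have "B i \<subseteq> inv_into T f ` f ` S" unfolding B_def using AS[OF that] by (rule image_mono)
    also have "\<dots> = S" using f S(2) by (rule inv_into_image_cancel)
    finally show ?thesis .
  qed
  show fB: "f ` B i = A i" if "i \<in> {1..m}" for i
    unfolding B_def using AS[OF that] S(2) by (intro image_inv_into_cancel[OF refl]) auto
  show BT: "finite (B i) \<and> B i \<subseteq> T" if "i \<in> {1..m}" for i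
    using BS[OF that] S finite_subset by auto
  show "equal_power_sums R S k m B"
    unfolding equal_power_sums_def
  proof (intro conjI ballI)
    fix i assume i: "i \<in> {1..m}"
    show "B i \<subseteq> S" using i by (rule BS)
    have "card (B i) = card (f ` B i)"
      using BT[OF i] f by (metis card_image inj_on_subset)
    then show "card (B i) = nat \<lceil>log 2 (real m)\<rceil> * 2 ^ k"
      using A i by (simp add: fB equal_power_sums_def)
  next
    fix j i assume j: "j \<in> {1..k}" and i: "i \<in> {1..m}"
    have 1: "1 \<in> {1..m}" using i by auto
    have "\<forall>j\<in>{1..k}. \<forall>i\<in>{1..m}. power_sum copy j (A i) = power_sum copy j (A 1)"
      using A unfolding equal_power_sums_def by (rule conjunct2)
    then have eq: "power_sum copy j (f ` B i) = power_sum copy j (f ` B 1)"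
      unfolding fB[OF i] fB[OF 1] using i j by blast
    have j1: "j \<ge> 1" using j by simp
    note pi = power_sum_copy[OF BT[OF i, THEN conjunct1] BT[OF i, THEN conjunct2] j1]
      and p1 = power_sum_copy[OF BT[OF 1, THEN conjunct1] BT[OF 1, THEN conjunct2] j1]
    have "f (power_sum R j (B i)) = f (power_sum R j (B 1))"
      using eq pi p1 by (metis (no_types))
    then show "power_sum R j (B i) = power_sum R j (B 1)"
      using pi p1 f_eq_iff by blast
  qed
qed

end

lemma energy_constant_nat_imp:
  assumes "energy_constant TYPE(nat) k m c"
  shows "energy_constant TYPE('a) k m c"
  unfolding energy_constant_def
proof (intro allI impI)
  fix R :: "'a ring" and S
  let ?cond = "\<lambda>R. domain R \<and> (ring_characteristic R = 0 \<or> ring_characteristic R > k + 1)"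
  assume R: "nonunital_ring R" and S: "S \<subseteq> carrier R" "finite S" "S \<noteq> {}"
    and E: "c * real (card S) powr (3 - 1 / (5 * (2 ^ (k + 1) - 1))) < real (additive_energy R S)"
  interpret nonunital_ring R by (rule R)
  \<comment> \<open>The identity is added so that the copy of a domain is a domain. The intersection
    guards against a field \<open>one\<close> outside the carrier.\<close>
  let ?B = "S \<union> ({\<one>\<^bsub>R\<^esub>} \<inter> carrier R)"
  have "countable ?B" "?B \<subseteq> carrier R" using S by (auto intro: countable_finite)
  then obtain T where TT: "countable T" "?B \<subseteq> T" "T \<subseteq> carrier R" "\<zero>\<^bsub>R\<^esub> \<in> T"
    "\<And>x. x \<in> T \<Longrightarrow> \<ominus>\<^bsub>R\<^esub> x \<in> T"
    "\<And>x y. x \<in> T \<Longrightarrow> y \<in> T \<Longrightarrow> x \<oplus>\<^bsub>R\<^esub> y \<in> T"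
    "\<And>x y. x \<in> T \<Longrightarrow> y \<in> T \<Longrightarrow> x \<otimes>\<^bsub>R\<^esub> y \<in> T"
    using ex_countable_subring by metis
  let ?f = "to_nat_on T"
  interpret subring_copy R T ?f
    by unfold_locales (use TT inj_on_to_nat_on in auto)
  have ST: "S \<subseteq> T" using TT by auto
  have cS: "card (?f ` S) = card S" using f ST by (metis card_image inj_on_subset)
  have "c * real (card (?f ` S)) powr (3 - 1 / (5 * (2 ^ (k + 1) - 1)))
      < real (additive_energy copy (?f ` S))"
    using E additive_energy_copy_ge[OF S(2) ST] by (simp add: cS)
  moreover have "?f ` S \<subseteq> carrier copy" "finite (?f ` S)" "?f ` S \<noteq> {}" using S ST by auto
  ultimately have *: "(\<exists>A. inj_on A {1..m} \<and> equal_power_sums copy (?f ` S) k m A) \<and>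
      (?cond copy \<longrightarrow> (\<exists>A. equal_power_sums copy (?f ` S) k m A \<and>
               (\<forall>h\<in>{1..m}. \<forall>t\<in>{1..m}. h \<noteq> t \<longrightarrow>
                  power_sum copy (k + 1) (A h) \<noteq> power_sum copy (k + 1) (A t))))"
    using assms nonunital_ring_copy unfolding energy_constant_def by blast
  show "(\<exists>A. inj_on A {1..m} \<and> equal_power_sums R S k m A) \<and>
      (?cond R \<longrightarrow> (\<exists>A. equal_power_sums R S k m A \<and>
               (\<forall>h\<in>{1..m}. \<forall>t\<in>{1..m}. h \<noteq> t \<longrightarrow>
                  power_sum R (k + 1) (A h) \<noteq> power_sum R (k + 1) (A t))))"
  proof (intro conjI impI)
    obtain A where A: "inj_on A {1..m}" "equal_power_sums copy (?f ` S) k m A" using * by blast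
    note B = equal_power_sums_pullback[OF S(2) ST A(2)]
    have "inj_on (\<lambda>i. inv_into T ?f ` A i) {1..m}"
    proof (rule inj_onI)
      fix i j assume ij: "i \<in> {1..m}" "j \<in> {1..m}" "inv_into T ?f ` A i = inv_into T ?f ` A j"
      then have "A i = A j" using B(2)[OF ij(1)] B(2)[OF ij(2)] by metis
      then show "i = j" using A(1) ij by (auto dest: inj_onD)
    qed
    then show "\<exists>A. inj_on A {1..m} \<and> equal_power_sums R S k m A"
      using B(1) by (intro exI conjI)
  next
    assume c: "?cond R"
    then interpret r: "domain" R by simp
    have "\<one>\<^bsub>R\<^esub> \<in> T" using TT by auto
    then have "?cond copy" using domain_copy c by simp
    from mp[OF conjunct2[OF *] this] obtain A where A: "equal_power_sums copy (?f ` S) k m A"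
      and ne: "\<forall>h\<in>{1..m}. \<forall>t\<in>{1..m}. h \<noteq> t \<longrightarrow>
        power_sum copy (k + 1) (A h) \<noteq> power_sum copy (k + 1) (A t)"
      by (elim exE conjE) (rule that)
    note B = equal_power_sums_pullback[OF S(2) ST A]
    let ?A = "\<lambda>i. inv_into T ?f ` A i"
    have ps: "power_sum copy (k + 1) (A i) = ?f (power_sum R (k + 1) (?A i))" if "i \<in> {1..m}" for i
      using power_sum_copy[of "?A i" "k + 1"] B(2,3)[OF that] by simp
    have "\<forall>h\<in>{1..m}. \<forall>t\<in>{1..m}. h \<noteq> t \<longrightarrow> power_sum R (k + 1) (?A h) \<noteq> power_sum R (k + 1) (?A t)"
    proof (intro ballI impI)
      fix h t assume ht: "h \<in> {1..m}" "t \<in> {1..m}" "h \<noteq> t"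
      then have "power_sum copy (k + 1) (A h) \<noteq> power_sum copy (k + 1) (A t)" using ne by blast
      then show "power_sum R (k + 1) (?A h) \<noteq> power_sum R (k + 1) (?A t)"
        using ps[OF ht(1)] ps[OF ht(2)] by auto
    qed
    with B(1) show "\<exists>A. equal_power_sums R S k m A \<and>
               (\<forall>h\<in>{1..m}. \<forall>t\<in>{1..m}. h \<noteq> t \<longrightarrow>
                  power_sum R (k + 1) (A h) \<noteq> power_sum R (k + 1) (A t))"
      by (intro exI conjI)
  qed
qed

theorem corollary1p3:
  fixes k m :: nat
  assumes "k \<ge> 1" and "m \<ge> 2"
  shows "(\<exists>c>0. energy_constant TYPE(nat) k m c) \<and>
         (\<forall>c>0. energy_constant TYPE(nat) k m c \<longrightarrow> energy_constant TYPE('a) k m c)"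
proof (intro conjI allI impI)
  have "m \<ge> 1" using assms by simp
  then have "energy_constant TYPE(nat) k m (energy_threshold k (nat \<lceil>log 2 (real m)\<rceil>))"
    by (rule energy_constant_threshold)
  then show "\<exists>c>0. energy_constant TYPE(nat) k m c"
    using energy_threshold_pos by (intro exI conjI)
qed (rule energy_constant_nat_imp)

end
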